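(* For every $k\ge1$, $$\sum_{\mu\in\mathcal P_k}s_\mu(\mathbf z_k)\,[\mathbf b]^k_\mu=\sigma_+(\mathbf z_k)[\mathbf b]^k_0 .$$
   Context: $V=\bigoplus_{i\ge0}\mathbb Q b_i$. $\mathcal P_k$ is the set of partitions of length at most $k$ (padded by zeros). For $\mu\in\mathcal P_k$, $[\mathbf b]^k_\mu=b_{k-1+\mu_1}\wedge b_{k-2+\mu_2}\wedge\cdots\wedge b_{\mu_k}\in\bigwedge^kV$; these form a basis of $\bigwedge^kV$; subscript $0$ denotes the empty partition. $\mathbf z_k=(z_1,\dots,z_k)$ are formal variables and $s_\mu(\mathbf z_k)=\det\big(z_j^{\mu_{k-i+1}+i-1}\big)_{1\le i,j\le k}\big/\prod_{i<j}(z_j-z_i)$ is the Schur polynomial. $\sigma_+(z):\bigwedge V\to\bigwedge V[[z]]$ is the unique $\mathbb Q$-linear map with $\sigma_+(z)1=1$, $\sigma_+(z)(u\wedge v)=\sigma_+(z)u\wedge\sigma_+(z)v$ and $\sigma_+(z)b_j=\sum_{i\ge0}b_{j+i}z^i$; $\sigma_+(\mathbf z_k)=\sigma_+(z_1)\cdots\sigma_+(z_k)$, each factor being extended linearly over power series in the other variables. *)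

theory Defs
  imports
    "HOL-Library.Poly_Mapping"
    "HOL-Computational_Algebra.Formal_Power_Series"
    "Jordan_Normal_Form.Determinant"
begin

section \<open>The exterior algebra\<close>

text \<open>The space \<open>V\<close> has the basis \<open>b\<^sub>0, b\<^sub>1, \<dots>\<close>, so its tensor algebra is the free associative
  \<open>\<rat>\<close>-algebra on these generators, i.e. the algebra of the free monoid of words in the indices.
  \<open>Poly_Mapping\<close> expects the monoid of exponents to be written additively; \<open>+\<close> on \<^typ>\<open>nat list\<close>
  is not available, hence the wrapper type.\<close>

datatype tword = Word (letters: "nat list")

instantiation tword :: monoid_add
begin

definition zero_tword :: tword where
  "0 = Word []"

definition plus_tword :: "tword \<Rightarrow> tword \<Rightarrow> tword" where
  "u + v = Word (letters u @ letters v)"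

instance
  by standard (simp_all add: zero_tword_def plus_tword_def)

end

type_synonym tensor = "tword \<Rightarrow>\<^sub>0 rat"

text \<open>The copy of \<open>V\<close> inside the tensor algebra.\<close>

definition tensor_deg1 :: "tensor set" where
  "tensor_deg1 = {v. \<forall>w \<in> Poly_Mapping.keys v. length (letters w) = 1}"

text \<open>The two-sided ideal generated by all \<open>v \<otimes> v\<close> with \<open>v \<in> V\<close>.\<close>

inductive_set alt_ideal :: "tensor set" where
  zero: "0 \<in> alt_ideal"
| add: "x \<in> alt_ideal \<Longrightarrow> y \<in> alt_ideal \<Longrightarrow> x + y \<in> alt_ideal"
| gen: "v \<in> tensor_deg1 \<Longrightarrow> a * (v * v) * c \<in> alt_ideal"

lemma alt_ideal_uminus: "x \<in> alt_ideal \<Longrightarrow> - x \<in> alt_ideal"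
proof (induction rule: alt_ideal.induct)
  case (gen v a c)
  then have "(- a) * (v * v) * c \<in> alt_ideal" by (rule alt_ideal.gen)
  then show ?case by simp
next
  case (add x y)
  then show ?case using alt_ideal.add[of "- x" "- y"] by simp
qed (auto intro: alt_ideal.zero)

lemma alt_ideal_mult_left: "x \<in> alt_ideal \<Longrightarrow> y * x \<in> alt_ideal"
proof (induction rule: alt_ideal.induct)
  case (gen v a c)
  then have "(y * a) * (v * v) * c \<in> alt_ideal" by (rule alt_ideal.gen)
  then show ?case by (simp add: mult.assoc)
qed (auto intro: alt_ideal.zero alt_ideal.add simp: distrib_left)

lemma alt_ideal_mult_right: "x \<in> alt_ideal \<Longrightarrow> x * y \<in> alt_ideal"
proof (induction rule: alt_ideal.induct)
  case (gen v a c)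
  then have "a * (v * v) * (c * y) \<in> alt_ideal" by (rule alt_ideal.gen)
  then show ?case by (simp add: mult.assoc)
qed (auto intro: alt_ideal.zero alt_ideal.add simp: distrib_right)

definition alt_rel :: "tensor \<Rightarrow> tensor \<Rightarrow> bool" where
  "alt_rel x y \<longleftrightarrow> x - y \<in> alt_ideal"

lemma alt_rel_refl: "alt_rel x x"
  by (simp add: alt_rel_def alt_ideal.zero)

lemma alt_rel_sym: "alt_rel x y \<Longrightarrow> alt_rel y x"
  unfolding alt_rel_def using alt_ideal_uminus by fastforce

lemma alt_rel_trans: "alt_rel x y \<Longrightarrow> alt_rel y z \<Longrightarrow> alt_rel x z"
  unfolding alt_rel_def using alt_ideal.add[of "x - y" "y - z"] by simp

lemma alt_rel_uminus: "alt_rel x y \<Longrightarrow> alt_rel (- x) (- y)"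
  unfolding alt_rel_def using alt_ideal_uminus[of "x - y"] by simp

lemma alt_rel_add: "alt_rel x x' \<Longrightarrow> alt_rel y y' \<Longrightarrow> alt_rel (x + y) (x' + y')"
  unfolding alt_rel_def using alt_ideal.add[of "x - x'" "y - y'"]
  by (simp add: algebra_simps)

lemma alt_rel_diff: "alt_rel x x' \<Longrightarrow> alt_rel y y' \<Longrightarrow> alt_rel (x - y) (x' - y')"
  using alt_rel_add[of x x' "- y" "- y'"] alt_rel_uminus by simp

lemma alt_rel_mult:
  assumes "alt_rel x x'" "alt_rel y y'"
  shows "alt_rel (x * y) (x' * y')"
proof -
  have "x * y - x' * y' = (x - x') * y + x' * (y - y')"
    by (simp add: algebra_simps)
  then show ?thesis
    using assms unfolding alt_rel_def
    by (metis alt_ideal.add alt_ideal_mult_left alt_ideal_mult_right)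
qed

quotient_type ext = "tensor" / alt_rel
  by (intro equivpI reflpI sympI transpI)
     (auto intro: alt_rel_refl alt_rel_sym alt_rel_trans)

lemma not_alt_rel_1_0: "\<not> alt_rel 1 0"
proof -
  have *: "Poly_Mapping.lookup x 0 = 0" if "x \<in> alt_ideal" for x
    using that
  proof (induction rule: alt_ideal.induct)
    case (gen v a c)
    show ?case
    proof (rule ccontr)
      assume "Poly_Mapping.lookup (a * (v * v) * c) 0 \<noteq> 0"
      then have "0 \<in> Poly_Mapping.keys (a * (v * v) * c)"
        by (simp add: in_keys_iff)
      then obtain p q where pq: "p \<in> Poly_Mapping.keys (a * (v * v))" "0 = p + q"
        using keys_mult by blast
      then obtain r s where rs: "s \<in> Poly_Mapping.keys (v * v)" "p = r + s"
        using keys_mult by blast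
      then obtain t u where tu: "t \<in> Poly_Mapping.keys v" "s = t + u"
        using keys_mult by blast
      then have "length (letters t) = 1"
        using gen by (auto simp: tensor_deg1_def)
      then show False
        using pq rs tu by (auto simp: zero_tword_def plus_tword_def)
    qed
  qed (simp_all add: lookup_add)
  show ?thesis
    using *[of 1] by (auto simp: alt_rel_def lookup_one)
qed

text \<open>The multiplication \<open>*\<close> on \<open>ext\<close> is the wedge product.\<close>

instantiation ext :: ring_1
begin

lift_definition zero_ext :: ext is 0 .
lift_definition one_ext :: ext is 1 .
lift_definition plus_ext :: "ext \<Rightarrow> ext \<Rightarrow> ext" is "(+)" by (rule alt_rel_add)
lift_definition minus_ext :: "ext \<Rightarrow> ext \<Rightarrow> ext" is "(-)" by (rule alt_rel_diff)
lift_definition uminus_ext :: "ext \<Rightarrow> ext" is uminus by (rule alt_rel_uminus)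
lift_definition times_ext :: "ext \<Rightarrow> ext \<Rightarrow> ext" is "(*)" by (rule alt_rel_mult)

instance
proof
  fix a b c :: ext
  show "a * b * c = a * (b * c)"
    by transfer (simp only: mult.assoc alt_rel_refl)
  show "a + b + c = a + (b + c)"
    by transfer (simp only: add.assoc alt_rel_refl)
  show "a + b = b + a"
    by transfer (simp only: add.commute alt_rel_refl)
  show "0 + a = a"
    by transfer (simp only: add_0_left alt_rel_refl)
  show "- a + a = 0"
    by transfer (simp only: left_minus alt_rel_refl)
  show "a - b = a + - b"
    by transfer (simp only: diff_conv_add_uminus alt_rel_refl)
  show "(a + b) * c = a * c + b * c"
    by transfer (simp only: distrib_right alt_rel_refl)
  show "a * (b + c) = a * b + a * c"
    by transfer (simp only: distrib_left alt_rel_refl)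
  show "1 * a = a"
    by transfer (simp only: mult_1_left alt_rel_refl)
  show "a * 1 = a"
    by transfer (simp only: mult_1_right alt_rel_refl)
  show "(0::ext) \<noteq> 1"
    using not_alt_rel_1_0 by transfer (auto dest: alt_rel_sym)
qed

end

lift_definition ext_of_rat :: "rat \<Rightarrow> ext" is "Poly_Mapping.single 0" .

definition ext_scale :: "rat \<Rightarrow> ext \<Rightarrow> ext" where
  "ext_scale c u = ext_of_rat c * u"

definition ext_fps_scale :: "rat \<Rightarrow> ext fps \<Rightarrow> ext fps" where
  "ext_fps_scale c F = Abs_fps (\<lambda>n. ext_scale c (fps_nth F n))"

lift_definition b_vec :: "nat \<Rightarrow> ext" is "\<lambda>j. Poly_Mapping.single (Word [j]) 1" .

text \<open>Partitions of length at most \<open>k\<close>, padded with zeros to exactly \<open>k\<close> entries.\<close>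

definition partitions :: "nat \<Rightarrow> nat list set" where
  "partitions k = {\<mu>. length \<mu> = k \<and> sorted_wrt (\<ge>) \<mu>}"

text \<open>With \<open>0\<close>-based list positions, the factor at position \<open>i\<close> is \<open>b\<close> with index
  \<open>k - (i + 1) + \<mu>\<^bsub>i+1\<^esub>\<close>.\<close>

definition b_wedge :: "nat \<Rightarrow> nat list \<Rightarrow> ext" where
  "b_wedge k \<mu> = prod_list (map (\<lambda>i. b_vec (k - 1 - i + \<mu> ! i)) [0..<k])"

section \<open>The map \<open>\<sigma>\<^sub>+(z)\<close>\<close>

text \<open>The product on \<^typ>\<open>ext fps\<close> is the wedge product extended by \<open>\<rat>[[z]]\<close>-bilinearity.\<close>

definition is_sigma_plus :: "(ext \<Rightarrow> ext fps) \<Rightarrow> bool" where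
  "is_sigma_plus \<sigma> \<longleftrightarrow>
     Vector_Spaces.linear ext_scale ext_fps_scale \<sigma> \<and>
     \<sigma> 1 = 1 \<and>
     (\<forall>u v. \<sigma> (u * v) = \<sigma> u * \<sigma> v) \<and>
     (\<forall>j. \<sigma> (b_vec j) = Abs_fps (\<lambda>i. b_vec (j + i)))"

definition sigma_plus :: "ext \<Rightarrow> ext fps" where
  "sigma_plus = (THE \<sigma>. is_sigma_plus \<sigma>)"

section \<open>Several variables\<close>

text \<open>Variables are numbered from \<open>0\<close>. A formal power series with coefficients in \<open>ext\<close> is the
  family of its coefficients, indexed by exponent vectors.\<close>

type_synonym ext_mps = "(nat \<Rightarrow>\<^sub>0 nat) \<Rightarrow> ext"

definition mps_const :: "ext \<Rightarrow> ext_mps" where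
  "mps_const u = (\<lambda>\<alpha>. if \<alpha> = 0 then u else 0)"

text \<open>\<open>\<sigma>\<^sub>+(z\<^sub>i)\<close> applied to \<open>\<Sum>\<^sub>\<alpha> F\<^sub>\<alpha> z\<^sup>\<alpha>\<close> is \<open>\<Sum>\<^sub>\<alpha> z\<^sup>\<alpha> \<sigma>\<^sub>+(z\<^sub>i) F\<^sub>\<alpha>\<close>; its coefficient at \<open>\<alpha>\<close>
  collects the ways of taking \<open>z\<^sub>i\<^sup>n\<close> from \<open>\<sigma>\<^sub>+(z\<^sub>i)\<close>.\<close>

definition sigma_var :: "nat \<Rightarrow> ext_mps \<Rightarrow> ext_mps" where
  "sigma_var i F =
     (\<lambda>\<alpha>. \<Sum>n\<le>Poly_Mapping.lookup \<alpha> i.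
        fps_nth (sigma_plus (F (\<alpha> - Poly_Mapping.single i n))) n)"

definition sigma_plus_multi :: "nat \<Rightarrow> ext \<Rightarrow> ext_mps" where
  "sigma_plus_multi k u = foldr sigma_var [0..<k] (mps_const u)"

type_synonym mpoly_rat = "(nat \<Rightarrow>\<^sub>0 nat) \<Rightarrow>\<^sub>0 rat"

definition z_var :: "nat \<Rightarrow> mpoly_rat" where
  "z_var i = Poly_Mapping.single (Poly_Mapping.single i 1) 1"

definition vandermonde :: "nat \<Rightarrow> mpoly_rat" where
  "vandermonde k = (\<Prod>(i, j) \<in> {(i, j). i < j \<and> j < k}. z_var j - z_var i)"

text \<open>Rows, columns and list positions start at \<open>0\<close>: row \<open>i\<close> has exponent \<open>\<mu>\<^bsub>k-i\<^esub> + i\<close>, where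
  \<open>\<mu>\<^bsub>k-i\<^esub>\<close> sits at position \<open>k - 1 - i\<close>.\<close>

definition alternant :: "nat \<Rightarrow> nat list \<Rightarrow> mpoly_rat" where
  "alternant k \<mu> = det (mat k k (\<lambda>(i, j). z_var j ^ (\<mu> ! (k - 1 - i) + i)))"

text \<open>The quotient in the polynomial ring, an integral domain; uniqueness is \<open>schur_eqI\<close> below.\<close>

definition schur :: "nat \<Rightarrow> nat list \<Rightarrow> mpoly_rat" where
  "schur k \<mu> = (THE s. s * vandermonde k = alternant k \<mu>)"

definition mpoly_scale :: "mpoly_rat \<Rightarrow> ext \<Rightarrow> ext_mps" where
  "mpoly_scale p u = (\<lambda>\<alpha>. ext_scale (Poly_Mapping.lookup p \<alpha>) u)"

text \<open>The (possibly infinite) family \<open>f\<close> of power series is summable over \<open>A\<close> in the formal sense,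
  i.e. only finitely many members contribute to each coefficient, and its sum is \<open>F\<close>.\<close>

definition has_formal_sum :: "('i \<Rightarrow> ext_mps) \<Rightarrow> 'i set \<Rightarrow> ext_mps \<Rightarrow> bool" where
  "has_formal_sum f A F \<longleftrightarrow>
     (\<forall>\<alpha>. finite {x \<in> A. f x \<alpha> \<noteq> 0} \<and> (\<Sum>x \<in> {x \<in> A. f x \<alpha> \<noteq> 0}. f x \<alpha>) = F \<alpha>)"

section \<open>Well-definedness\<close>

text \<open>The map \<open>\<sigma>\<^sub>+(z)\<close> exists and is unique: it is induced by the homomorphism \<open>tensor_sigma\<close> on
  the tensor algebra, which annihilates \<open>alt_ideal\<close>.\<close>

lemma vandermonde_nonzero: "vandermonde k \<noteq> 0"
proof -
  have "finite {(i, j). i < j \<and> j < k}"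
    by (rule finite_subset[of _ "{..<k} \<times> {..<k}"]) auto
  moreover have "z_var j - z_var i \<noteq> 0" if "i < j" for i j
  proof
    assume "z_var j - z_var i = 0"
    then have "Poly_Mapping.lookup (z_var j) (Poly_Mapping.single j 1) =
        Poly_Mapping.lookup (z_var i) (Poly_Mapping.single j 1)" by simp
    then have "Poly_Mapping.single i (1::nat) = Poly_Mapping.single j 1"
      by (auto simp: z_var_def lookup_single when_def split: if_splits)
    then have "Poly_Mapping.lookup (Poly_Mapping.single i (1::nat)) j =
        Poly_Mapping.lookup (Poly_Mapping.single j 1) j" by simp
    then show False
      using that by (auto simp: lookup_single when_def)
  qed
  ultimately show ?thesis
    unfolding vandermonde_def by (auto simp: prod_zero_iff)
qed

lemma schur_eqI:
  assumes "s * vandermonde k = alternant k \<mu>"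
  shows "schur k \<mu> = s"
  unfolding schur_def
proof (rule the_equality)
  fix t assume "t * vandermonde k = alternant k \<mu>"
  with assms have "t * vandermonde k = s * vandermonde k" by simp
  then show "t = s" using vandermonde_nonzero mult_right_cancel by blast
qed (rule assms)

lemma ext_of_rat_simps:
  "ext_of_rat (c + d) = ext_of_rat c + ext_of_rat d"
  "ext_of_rat (c * d) = ext_of_rat c * ext_of_rat d"
  "ext_of_rat 1 = 1"
  "ext_of_rat 0 = 0"
  by (transfer; simp add: single_add mult_single alt_rel_refl)+

lemma tensor_induct [case_names single sum]:
  fixes p :: tensor
  assumes single: "\<And>w c. P (Poly_Mapping.single w c)"
    and sum: "\<And>p q. P p \<Longrightarrow> P q \<Longrightarrow> P (p + q)"
  shows "P p"
proof (induction p rule: update_induct)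
  case const
  then show ?case using single[of 0 0] by simp
next
  case (update f w c)
  have "Poly_Mapping.update w c f = f + Poly_Mapping.single w c"
    using update(1)
    by (auto intro!: poly_mapping_eqI simp: lookup_add lookup_update lookup_single in_keys_iff when_def)
  then show ?case using sum[OF update(3) single] by simp
qed

lemma ext_of_rat_commute: "u * ext_of_rat c = ext_of_rat c * u"
proof (transfer)
  fix u :: tensor and c
  have "u * Poly_Mapping.single 0 c = Poly_Mapping.single 0 c * u"
  proof (induction u rule: tensor_induct)
    case (single w x)
    then show ?case by (simp add: mult_single mult.commute)
  next
    case (sum u v)
    then show ?case by (simp add: algebra_simps)
  qed
  then show "alt_rel (u * Poly_Mapping.single 0 c) (Poly_Mapping.single 0 c * u)"
    by (simp add: alt_rel_refl)
qed

lemma vector_space_ext: "vector_space ext_scale"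
  by standard (simp_all add: ext_scale_def ext_of_rat_simps algebra_simps)

lemma ext_fps_scale_conv: "ext_fps_scale c F = fps_const (ext_of_rat c) * F"
  by (simp add: fps_eq_iff ext_fps_scale_def ext_scale_def)

lemma vector_space_ext_fps: "vector_space ext_fps_scale"
  by standard
     (simp_all add: fps_eq_iff ext_fps_scale_def ext_scale_def ext_of_rat_simps algebra_simps)

lemma ext_fps_scale_mult:
  "ext_fps_scale c F * ext_fps_scale d G = ext_fps_scale (c * d) (F * G)"
proof -
  let ?c = "fps_const (ext_of_rat c)" and ?d = "fps_const (ext_of_rat d)"
  have comm: "F * ?d = ?d * F"
    by (simp add: fps_eq_iff ext_of_rat_commute)
  have "ext_fps_scale c F * ext_fps_scale d G = ?c * (F * ?d) * G"
    by (simp only: ext_fps_scale_conv mult.assoc)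
  also have "\<dots> = ?c * ?d * (F * G)"
    by (simp only: comm mult.assoc)
  finally show ?thesis
    by (simp add: ext_fps_scale_conv ext_of_rat_simps)
qed

definition tensor_sigma :: "tensor \<Rightarrow> ext fps" where
  "tensor_sigma p = (\<Sum>w \<in> Poly_Mapping.keys p. ext_fps_scale (Poly_Mapping.lookup p w)
     (prod_list (map (\<lambda>j. Abs_fps (\<lambda>i. b_vec (j + i))) (letters w))))"

interpretation fpsv: vector_space ext_fps_scale by (rule vector_space_ext_fps)

interpretation extv: vector_space ext_scale by (rule vector_space_ext)

lemma tensor_sigma_superset:
  assumes "finite A" "Poly_Mapping.keys p \<subseteq> A"
  shows "tensor_sigma p = (\<Sum>w \<in> A. ext_fps_scale (Poly_Mapping.lookup p w)
     (prod_list (map (\<lambda>j. Abs_fps (\<lambda>i. b_vec (j + i))) (letters w))))"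
  unfolding tensor_sigma_def using assms
  by (intro sum.mono_neutral_left) (auto simp: in_keys_iff)

lemma tensor_sigma_add: "tensor_sigma (p + q) = tensor_sigma p + tensor_sigma q"
proof -
  let ?A = "Poly_Mapping.keys p \<union> Poly_Mapping.keys q"
  have fin: "finite ?A" by simp
  have "Poly_Mapping.keys (p + q) \<subseteq> ?A" by (rule keys_add)
  then show ?thesis
    using tensor_sigma_superset[OF fin, of p] tensor_sigma_superset[OF fin, of q]
      tensor_sigma_superset[OF fin, of "p + q"]
    by (simp add: lookup_add fpsv.scale_left_distrib sum.distrib)
qed

lemma tensor_sigma_single:
  "tensor_sigma (Poly_Mapping.single w c) =
     ext_fps_scale c (prod_list (map (\<lambda>j. Abs_fps (\<lambda>i. b_vec (j + i))) (letters w)))"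
  by (subst tensor_sigma_superset[of "{w}"]) auto

lemma tensor_sigma_mult: "tensor_sigma (p * q) = tensor_sigma p * tensor_sigma q"
proof (induction p rule: tensor_induct)
  case (single u c)
  show ?case
  proof (induction q rule: tensor_induct)
    case (single v d)
    then show ?case
      by (simp add: mult_single tensor_sigma_single ext_fps_scale_mult plus_tword_def)
  next
    case (sum q r)
    then show ?case by (simp add: distrib_left tensor_sigma_add)
  qed
next
  case (sum p r)
  then show ?case by (simp add: distrib_right tensor_sigma_add)
qed

definition ext_deg1 :: "ext set" where
  "ext_deg1 = abs_ext ` tensor_deg1"

lemma ext_deg1_square: "u \<in> ext_deg1 \<Longrightarrow> u * u = 0"
proof -
  assume "u \<in> ext_deg1"
  then obtain v where v: "v \<in> tensor_deg1" "u = abs_ext v" by (auto simp: ext_deg1_def)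
  then have "v * v \<in> alt_ideal" using alt_ideal.gen[of v 1 1] by simp
  then show ?thesis
    using v by (simp add: times_ext.abs_eq zero_ext_def ext.abs_eq_iff alt_rel_def)
qed

lemma ext_deg1_0: "0 \<in> ext_deg1"
  by (auto simp: ext_deg1_def zero_ext_def tensor_deg1_def)

lemma ext_deg1_add: "u \<in> ext_deg1 \<Longrightarrow> v \<in> ext_deg1 \<Longrightarrow> u + v \<in> ext_deg1"
proof -
  assume "u \<in> ext_deg1" "v \<in> ext_deg1"
  then obtain x y where "x \<in> tensor_deg1" "y \<in> tensor_deg1" "u = abs_ext x" "v = abs_ext y"
    by (auto simp: ext_deg1_def)
  moreover from this have "x + y \<in> tensor_deg1"
    using keys_add[of x y] by (fastforce simp: tensor_deg1_def)
  ultimately show ?thesis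
    by (auto simp: ext_deg1_def plus_ext.abs_eq)
qed

lemma ext_deg1_sum: "(\<And>x. x \<in> A \<Longrightarrow> f x \<in> ext_deg1) \<Longrightarrow> sum f A \<in> ext_deg1"
  by (induction A rule: infinite_finite_induct) (auto simp: ext_deg1_0 ext_deg1_add)

lemma ext_deg1_anticommute:
  assumes "u \<in> ext_deg1" "v \<in> ext_deg1"
  shows "u * v = - (v * u)"
proof -
  have "(u + v) * (u + v) = 0" using assms by (intro ext_deg1_square ext_deg1_add)
  then show ?thesis
    using assms by (simp add: algebra_simps ext_deg1_square eq_neg_iff_add_eq_0)
qed

lemma ext_scale_b_vec: "ext_scale c (b_vec j) \<in> ext_deg1"
proof -
  have "ext_scale c (b_vec j) = abs_ext (Poly_Mapping.single (Word [j]) c)"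
    by (simp add: ext_scale_def ext_of_rat.abs_eq b_vec.abs_eq times_ext.abs_eq mult_single)
  then show ?thesis by (auto simp: ext_deg1_def tensor_deg1_def)
qed

lemma tensor_sigma_deg1:
  assumes "v \<in> tensor_deg1"
  shows "fps_nth (tensor_sigma v) n \<in> ext_deg1"
proof -
  have "fps_nth (ext_fps_scale (Poly_Mapping.lookup v w)
     (prod_list (map (\<lambda>j. Abs_fps (\<lambda>i. b_vec (j + i))) (letters w)))) n \<in> ext_deg1"
    if "w \<in> Poly_Mapping.keys v" for w
  proof -
    from that assms obtain j where "letters w = [j]"
      by (fastforce simp: tensor_deg1_def length_Suc_conv)
    then show ?thesis by (simp add: ext_fps_scale_def ext_scale_b_vec)
  qed
  then show ?thesis
    unfolding tensor_sigma_def by (auto simp: fps_sum_nth intro: ext_deg1_sum)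
qed

lemma tensor_sigma_square:
  assumes "v \<in> tensor_deg1"
  shows "tensor_sigma v * tensor_sigma v = 0"
proof (rule fps_ext)
  fix n
  let ?f = "fps_nth (tensor_sigma v)"
  let ?X = "\<Sum>i=0..n. ?f i * ?f (n - i)"
  have "?X = (\<Sum>i=0..n. - (?f (n - i) * ?f i))"
    by (intro sum.cong refl ext_deg1_anticommute tensor_sigma_deg1 assms)
  also have "\<dots> = - (\<Sum>i=0..n. ?f (n - i) * ?f i)" by (rule sum_negf)
  also have "(\<Sum>i=0..n. ?f (n - i) * ?f i) = ?X"
    by (subst sum.atLeastAtMost_rev) (auto intro!: sum.cong)
  finally have "?X + ?X = 0" by (simp add: eq_neg_iff_add_eq_0)
  then have "ext_scale (1 / 2) (?X + ?X) = 0" by simp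
  also have "ext_scale (1 / 2) (?X + ?X) = ext_scale (1 / 2 + 1 / 2) ?X"
    by (simp only: extv.scale_left_distrib extv.scale_right_distrib)
  finally have "?X = 0" by simp
  then show "fps_nth (tensor_sigma v * tensor_sigma v) n = fps_nth 0 n"
    by (simp add: fps_mult_nth)
qed

lemma tensor_sigma_ideal: "x \<in> alt_ideal \<Longrightarrow> tensor_sigma x = 0"
proof (induction rule: alt_ideal.induct)
  case zero
  then show ?case by (simp add: tensor_sigma_def)
qed (simp_all add: tensor_sigma_add tensor_sigma_mult tensor_sigma_square)

lift_definition ext_sigma :: "ext \<Rightarrow> ext fps" is tensor_sigma
proof -
  fix x y assume "alt_rel x y"
  then have "tensor_sigma (x - y) = 0" by (simp add: alt_rel_def tensor_sigma_ideal)
  then show "tensor_sigma x = tensor_sigma y"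
    using tensor_sigma_add[of "x - y" y] by simp
qed

lemma is_sigma_plus_ext_sigma: "is_sigma_plus ext_sigma"
proof -
  have add: "ext_sigma (u + v) = ext_sigma u + ext_sigma v" for u v
    by transfer (rule tensor_sigma_add)
  have mult: "ext_sigma (u * v) = ext_sigma u * ext_sigma v" for u v
    by transfer (rule tensor_sigma_mult)
  have const: "ext_sigma (ext_of_rat c) = ext_fps_scale c 1" for c
    by transfer (simp add: tensor_sigma_single zero_tword_def)
  have "ext_sigma (ext_scale c u) = ext_fps_scale c (ext_sigma u)" for c u
    by (simp add: ext_scale_def mult const ext_fps_scale_conv)
  moreover have "ext_sigma 1 = 1"
    using const[of 1] by (simp add: ext_of_rat_simps)
  moreover have "ext_sigma (b_vec j) = Abs_fps (\<lambda>i. b_vec (j + i))" for j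
    by transfer (simp add: tensor_sigma_single)
  moreover have "module_hom ext_scale ext_fps_scale ext_sigma"
    by unfold_locales (auto simp: add calculation)
  ultimately show ?thesis
    unfolding is_sigma_plus_def
    by (simp add: mult Vector_Spaces.linear_def vector_space_ext vector_space_ext_fps)
qed

lemma is_sigma_plus_unique:
  assumes "is_sigma_plus \<sigma>" "is_sigma_plus \<tau>"
  shows "\<sigma> = \<tau>"
proof
  interpret s: Vector_Spaces.linear ext_scale ext_fps_scale \<sigma>
    using assms(1) by (simp add: is_sigma_plus_def)
  interpret t: Vector_Spaces.linear ext_scale ext_fps_scale \<tau>
    using assms(2) by (simp add: is_sigma_plus_def)
  fix u
  obtain p where u: "u = abs_ext p"
    using ext.abs_induct[of "\<lambda>u. \<exists>p. u = abs_ext p"] by blast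
  have word: "abs_ext (Poly_Mapping.single w c) =
      ext_scale c (prod_list (map b_vec (letters w)))" for w c
  proof -
    have 1: "prod_list (map b_vec xs) = abs_ext (Poly_Mapping.single (Word xs) 1)" for xs
    proof (induction xs)
      case Nil
      then show ?case by (simp add: one_ext_def flip: zero_tword_def)
    next
      case (Cons x xs)
      then show ?case
        by (simp add: b_vec.abs_eq times_ext.abs_eq mult_single plus_tword_def)
    qed
    show ?thesis
      using 1[of "letters w"]
      by (simp add: ext_scale_def ext_of_rat.abs_eq times_ext.abs_eq mult_single)
  qed
  have prod: "\<sigma> (prod_list (map b_vec xs)) = \<tau> (prod_list (map b_vec xs))" for xs
    using assms by (induction xs) (simp_all add: is_sigma_plus_def)
  have "\<sigma> (abs_ext p) = \<tau> (abs_ext p)"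
  proof (induction p rule: tensor_induct)
    case (single w c)
    then show ?case by (simp add: word s.scale t.scale prod)
  next
    case (sum p q)
    then show ?case by (simp add: s.add t.add flip: plus_ext.abs_eq)
  qed
  then show "\<sigma> u = \<tau> u" by (simp add: u)
qed

lemma is_sigma_plus_sigma_plus: "is_sigma_plus sigma_plus"
  unfolding sigma_plus_def
  by (rule theI[of is_sigma_plus, OF is_sigma_plus_ext_sigma]) (rule is_sigma_plus_unique[OF _ is_sigma_plus_ext_sigma])

end

theory Submission
  imports Defs
begin

text \<open>Since \<open>\<sigma>\<^sub>+(z\<^sub>1) \<cdots> \<sigma>\<^sub>+(z\<^sub>k)\<close> is multiplicative and sends \<open>b\<^sub>j\<close> to \<open>\<Sum>\<^sub>n h\<^sub>n b\<^bsub>j+n\<^esub>\<close>, with \<open>h\<^sub>n\<close> the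
  complete symmetric polynomials, expanding its value on \<open>b\<^bsub>k-1\<^esub> \<and> \<dots> \<and> b\<^sub>0\<close> and collecting the terms that
  differ by a permutation of the wedge factors gives \<open>\<Sum>\<^sub>\<mu> det (h\<^bsub>\<mu>\<^sub>i-i+j\<^esub>) [b]\<^sub>\<mu>\<close>. By the Jacobi--Trudi formula,
  these determinants are the Schur polynomials. Only monomials up to the total degree of the
  inspected coefficient contribute, so all sums can be truncated to indices below a bound \<open>M\<close>.\<close>

section \<open>The Jacobi--Trudi formula\<close>

text \<open>The same permutation acts on rows and on columns, so its sign enters twice and cancels.
  This reconciles the alternant, whose rows start from the last part of the partition, with wedge
  products, which start from the first.\<close>

lemma det_reverse:
  assumes A: "A \<in> carrier_mat n n"
  shows "det (mat n n (\<lambda>(i, j). A $$ (n - 1 - i, n - 1 - j))) = det A"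
proof -
  define p where "p = (\<lambda>i. if i < n then n - 1 - i else i)"
  have p: "p permutes {0..<n}"
    by (rule bij_imp_permutes) (auto simp: p_def intro!: bij_betwI[where g = p])
  define B where "B = mat n n (\<lambda>(i, j). A $$ (p i, j))"
  have B: "B \<in> carrier_mat n n" by (simp add: B_def)
  have "det B = signof p * det A"
    unfolding B_def by (rule det_permute_rows[OF A p])
  \<comment> \<open>The row rule is applied again to the transpose, so that it now permutes
    columns.\<close>
  moreover have "det (mat n n (\<lambda>(i, j). B\<^sup>T $$ (p i, j))) = signof p * det (B\<^sup>T)"
    using B by (intro det_permute_rows p) auto
  moreover have "det (B\<^sup>T) = det B"
    by (rule det_transpose[OF B])
  moreover have "mat n n (\<lambda>(i, j). A $$ (n - 1 - i, n - 1 - j)) =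
      (mat n n (\<lambda>(i, j). B\<^sup>T $$ (p i, j)))\<^sup>T"
    by (rule eq_matI) (auto simp: B_def p_def)
  moreover have "det ((mat n n (\<lambda>(i, j). B\<^sup>T $$ (p i, j)))\<^sup>T) = det (mat n n (\<lambda>(i, j). B\<^sup>T $$ (p i, j)))"
    by (intro det_transpose[of _ n]) auto
  moreover have "signof p * (signof p * det A) = det A"
    by (simp add: sign_def)
  ultimately show ?thesis by simp
qed

lemma prod_list_diag_mat: "prod_list (diag_mat A) = (\<Prod>i<dim_row A. A $$ (i, i))"
  by (simp add: diag_mat_def prod.list_conv_set_nth atLeast0LessThan)

text \<open>The Newton basis \<open>\<Prod>\<^sub>l\<^sub><\<^sub>i (x - z\<^sub>l)\<close> is related to the monomials by a unitriangular matrix and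
  evaluates to an upper triangular matrix.\<close>

lemma det_vandermonde:
  fixes z :: "nat \<Rightarrow> 'a::idom"
  shows "det (mat k k (\<lambda>(i, j). z j ^ i)) = (\<Prod>(i, j) \<in> {(i, j). i < j \<and> j < k}. z j - z i)"
proof -
  define p where "p i = (\<Prod>l<i. [:- z l, 1:])" for i
  have deg: "degree (p i) = i" for i
    unfolding p_def by (simp add: degree_prod_eq_sum_degree)
  have lead: "poly.coeff (p i) i = 1" for i
    using lead_coeff_prod[of "\<lambda>l. [:- z l, 1:]" "{..<i}"] by (simp add: deg flip: p_def)
  define L where "L = mat k k (\<lambda>(i, m). poly.coeff (p i) m)"
  define W where "W = mat k k (\<lambda>(i, j). z j ^ i)"
  have [simp]: "L \<in> carrier_mat k k" "W \<in> carrier_mat k k"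
    by (simp_all add: L_def W_def)
  have LW: "(L * W) $$ (i, j) = poly (p i) (z j)" if "i < k" "j < k" for i j
  proof -
    have "(L * W) $$ (i, j) = (\<Sum>m<k. poly.coeff (p i) m * z j ^ m)"
      using that by (simp add: L_def W_def scalar_prod_def atLeast0LessThan)
    also have "\<dots> = (\<Sum>m\<le>i. poly.coeff (p i) m * z j ^ m)"
      using that by (intro sum.mono_neutral_right) (auto simp: deg coeff_eq_0)
    finally show ?thesis by (simp add: poly_altdef deg)
  qed
  have "det L = (\<Prod>i<k. L $$ (i, i))"
    by (subst det_lower_triangular[of k])
       (auto simp: L_def prod_list_diag_mat deg intro!: coeff_eq_0)
  also have "\<dots> = 1" by (simp add: L_def lead)
  finally have "det L = 1" .
  moreover have "det (L * W) = det L * det W" by (rule det_mult[of _ k]) auto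
  moreover have "det (L * W) = (\<Prod>i<k. (L * W) $$ (i, i))"
  proof -
    \<comment> \<open>Below the diagonal \<open>j < i\<close>, and the factor of \<open>p i\<close>
      with \<open>l = j\<close> vanishes at \<open>z j\<close>.\<close>
    have "upper_triangular (L * W)"
      using LW by (intro upper_triangularI) (auto simp: L_def p_def poly_prod)
    moreover have "L * W \<in> carrier_mat k k" by (rule mult_carrier_mat[of L k k W k]) auto
    ultimately show ?thesis
      using det_upper_triangular[of "L * W" k] by (simp add: prod_list_diag_mat L_def)
  qed
  moreover have "(\<Prod>j<k. (L * W) $$ (j, j)) = (\<Prod>j<k. \<Prod>i<j. z j - z i)"
    by (intro prod.cong) (auto simp: LW p_def poly_prod)
  moreover have "(\<Prod>j<k. \<Prod>i<j. z j - z i) = (\<Prod>(i, j) \<in> {(i, j). i < j \<and> j < k}. z j - z i)"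
    unfolding prod.Sigma[OF finite_lessThan ballI[OF finite_lessThan]]
    by (rule prod.reindex_bij_witness[of _ "\<lambda>(i, j). (j, i)" "\<lambda>(i, j). (j, i)"]) auto
  ultimately show ?thesis by (simp add: W_def)
qed

section \<open>Generating functions of the complete symmetric polynomials\<close>

definition geometric_fps :: "'a::comm_ring_1 \<Rightarrow> 'a fps" where
  "geometric_fps c = Abs_fps (\<lambda>n. c ^ n)"

lemma geometric_fps_inverse: "geometric_fps c * (1 - fps_const c * fps_X) = 1"
proof (rule fps_ext)
  fix n
  have "geometric_fps c * (1 - fps_const c * fps_X) =
      geometric_fps c - fps_const c * (geometric_fps c * fps_X)"
    by (simp add: algebra_simps)
  then show "fps_nth (geometric_fps c * (1 - fps_const c * fps_X)) n = fps_nth 1 n"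
    by (cases n) (simp_all add: geometric_fps_def)
qed

text \<open>Each linear factor raises the degree by at most one. This is what cuts the expansion of
  a power of a variable down to \<open>k\<close> terms.\<close>

lemma fps_nth_prod_linear_eq_0:
  fixes c :: "'i \<Rightarrow> 'a::comm_ring_1"
  assumes "finite A" "card A < n"
  shows "fps_nth (\<Prod>i\<in>A. 1 - fps_const (c i) * fps_X) n = 0"
  using assms
proof (induction A arbitrary: n rule: finite_induct)
  case (insert x F)
  then obtain m where m: "n = Suc m" "card F < m" by (cases n) auto
  let ?P = "\<Prod>i\<in>F. 1 - fps_const (c i) * fps_X"
  have "(1 - fps_const (c x) * fps_X) * ?P = ?P - fps_const (c x) * (fps_X * ?P)"
    by (simp add: algebra_simps)
  then show ?case using insert m by simp
qed auto

text \<open>With \<open>H = 1 / \<Prod>\<^sub>i (1 - z\<^sub>i X)\<close>, the series \<open>1 / (1 - z\<^sub>j X)\<close> is \<open>H\<close> times a polynomial of degree below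
  \<open>k\<close>. This factors each alternant matrix through a fixed matrix \<open>E\<close>.\<close>

definition complete_sym :: "nat set \<Rightarrow> nat \<Rightarrow> mpoly_rat" where
  "complete_sym I n = fps_nth (\<Prod>i\<in>I. geometric_fps (z_var i)) n"

text \<open>This is \<open>h_(m-l)\<close> with the convention that \<open>h_n\<close> is 0 for
  negative \<open>n\<close>; truncated subtraction alone would give \<open>h_0 = 1\<close> for
  \<open>l > m\<close>.\<close>

definition complete_sym_diff :: "nat set \<Rightarrow> nat \<Rightarrow> nat \<Rightarrow> mpoly_rat" where
  "complete_sym_diff I m l = (if l \<le> m then complete_sym I (m - l) else 0)"

lemma complete_sym_0: "complete_sym I 0 = 1"
  by (induction I rule: infinite_finite_induct) (simp_all add: complete_sym_def geometric_fps_def)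

lemma z_var_power_conv_complete_sym:
  assumes "j < k"
  shows "z_var j ^ m = (\<Sum>l<k. complete_sym_diff {..<k} m l *
    fps_nth (\<Prod>i\<in>{..<k} - {j}. 1 - fps_const (z_var i) * fps_X) l)"
proof -
  let ?g = "\<lambda>i. geometric_fps (z_var i)" and ?q = "\<lambda>i. 1 - fps_const (z_var i) * fps_X"
  let ?Q = "\<Prod>i\<in>{..<k} - {j}. ?q i"
  have "(\<Prod>i<k. ?g i) = ?g j * (\<Prod>i\<in>{..<k} - {j}. ?g i)"
    using assms by (intro prod.remove) auto
  \<comment> \<open>Multiplication by \<open>?Q\<close> cancels every geometric series except the
    one of \<open>z_var j\<close>.\<close>
  then have "(\<Prod>i<k. ?g i) * ?Q = ?g j * (\<Prod>i\<in>{..<k} - {j}. ?g i * ?q i)"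
    by (simp add: prod.distrib mult.assoc)
  also have "\<dots> = ?g j" by (simp add: geometric_fps_inverse)
  finally have g: "?g j = ?Q * (\<Prod>i<k. ?g i)" by (simp only: mult.commute)
  have "z_var j ^ m = fps_nth (?g j) m" by (simp add: geometric_fps_def)
  also have "\<dots> = (\<Sum>l\<le>m. complete_sym {..<k} (m - l) * fps_nth ?Q l)"
    by (subst g) (simp add: fps_mult_nth complete_sym_def atMost_atLeast0 mult.commute[of "fps_nth ?Q _"])
  also have "\<dots> = (\<Sum>l\<le>m. complete_sym_diff {..<k} m l * fps_nth ?Q l)"
    by (simp add: complete_sym_diff_def)
  \<comment> \<open>Since \<open>m\<close> may lie on either side of \<open>k\<close>, the range is
    first enlarged by zero terms to contain both; it is then cut at \<open>k\<close>, because
    \<open>?Q\<close> has only \<open>k - 1\<close> linear factors.\<close>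
  also have "\<dots> = (\<Sum>l<k + Suc m. complete_sym_diff {..<k} m l * fps_nth ?Q l)"
    by (intro sum.mono_neutral_left) (auto simp: complete_sym_diff_def)
  also have "\<dots> = (\<Sum>l<k. complete_sym_diff {..<k} m l * fps_nth ?Q l)"
    using assms by (intro sum.mono_neutral_right) (auto intro!: fps_nth_prod_linear_eq_0)
  finally show ?thesis .
qed

text \<open>For any row exponents \<open>r\<close>, the matrix of powers factors as
  \<open>H r * E\<close>, where \<open>E\<close> does not depend on \<open>r\<close>. Hence it
  suffices to identify \<open>det E\<close> with the Vandermonde product.\<close>

lemma jacobi_trudi:
  "schur k \<mu> = det (mat k k (\<lambda>(i, l). complete_sym_diff {..<k} (\<mu> ! (k - 1 - i) + i) l))"
proof (rule schur_eqI)
  define H where "H r = mat k k (\<lambda>(i, l). complete_sym_diff {..<k} (r i) l)" for r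
  define E where "E = mat k k (\<lambda>(l, j).
    fps_nth (\<Prod>i\<in>{..<k} - {j}. 1 - fps_const (z_var i) * fps_X) l)"
  have [simp]: "H r \<in> carrier_mat k k" "E \<in> carrier_mat k k" for r
    by (simp_all add: H_def E_def)
  have "mat k k (\<lambda>(i, j). z_var j ^ r i) = H r * E" for r
  proof (rule eq_matI)
    fix i j assume "i < dim_row (H r * E)" "j < dim_col (H r * E)"
    then have "i < k" "j < k" by (simp_all add: H_def E_def)
    then show "mat k k (\<lambda>(i, j). z_var j ^ r i) $$ (i, j) = (H r * E) $$ (i, j)"
      using z_var_power_conv_complete_sym[of j k "r i"]
      by (simp add: H_def E_def scalar_prod_def atLeast0LessThan)
  qed (simp_all add: H_def E_def)
  then have det: "det (mat k k (\<lambda>(i, j). z_var j ^ r i)) = det (H r) * det E" for r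
    by (simp add: det_mult[of _ k])
  \<comment> \<open>The exponents \<open>0, ..., k - 1\<close> give the Vandermonde matrix, while
    \<open>H id\<close> is lower triangular with diagonal entries \<open>h_0 = 1\<close>.\<close>
  have "det (H id) = (\<Prod>i<k. H id $$ (i, i))"
    by (subst det_lower_triangular[of k]) (auto simp: H_def prod_list_diag_mat complete_sym_diff_def)
  also have "\<dots> = 1"
    by (simp add: H_def complete_sym_diff_def complete_sym_0)
  finally have "det E = vandermonde k"
    using det[of id] det_vandermonde[of k z_var] by (simp add: vandermonde_def)
  then show "det (mat k k (\<lambda>(i, l). complete_sym_diff {..<k} (\<mu> ! (k - 1 - i) + i) l)) * vandermonde k =
      alternant k \<mu>"
    using det[of "\<lambda>i. \<mu> ! (k - 1 - i) + i"] by (simp add: alternant_def H_def)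
qed

section \<open>Expansion of \<open>\<sigma>\<^sub>+\<close> on wedge products\<close>

definition splits :: "('a \<Rightarrow>\<^sub>0 nat) \<Rightarrow> (('a \<Rightarrow>\<^sub>0 nat) \<times> ('a \<Rightarrow>\<^sub>0 nat)) set" where
  "splits \<alpha> = {(\<beta>, \<gamma>). \<beta> + \<gamma> = \<alpha>}"

text \<open>Both summands are bounded pointwise by \<alpha>. They are thus determined by their
  values on the finite support of \<alpha>, where only finitely many values are possible.\<close>

lemma finite_splits: "finite (splits \<alpha>)"
proof -
  define A where "A = {\<beta>. \<forall>i. Poly_Mapping.lookup \<beta> i \<le> Poly_Mapping.lookup \<alpha> i}"
  define f where "f \<beta> = restrict (Poly_Mapping.lookup \<beta>) (Poly_Mapping.keys \<alpha>)" for \<beta> :: "'a \<Rightarrow>\<^sub>0 nat"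
  have "inj_on f A"
  proof (rule inj_onI, rule poly_mapping_eqI)
    fix \<beta> \<gamma> i assume *: "\<beta> \<in> A" "\<gamma> \<in> A" "f \<beta> = f \<gamma>"
    show "Poly_Mapping.lookup \<beta> i = Poly_Mapping.lookup \<gamma> i"
    proof (cases "i \<in> Poly_Mapping.keys \<alpha>")
      case True
      then show ?thesis using fun_cong[OF *(3), of i] by (simp add: f_def)
    next
      case False
      then have "Poly_Mapping.lookup \<alpha> i = 0" by (simp add: in_keys_iff)
      then show ?thesis using *(1,2) unfolding A_def by (metis (mono_tags) le_zero_eq mem_Collect_eq)
    qed
  qed
  moreover have "finite (f ` A)"
    by (rule finite_subset[of _ "Pi\<^sub>E (Poly_Mapping.keys \<alpha>) (\<lambda>i. {..Poly_Mapping.lookup \<alpha> i})"])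
       (auto simp: f_def A_def intro!: finite_PiE)
  ultimately have "finite A" by (rule finite_imageD[rotated])
  moreover have "splits \<alpha> \<subseteq> A \<times> A"
    by (auto simp: splits_def A_def lookup_add)
  ultimately show ?thesis by (meson finite_SigmaI finite_subset)
qed

lemma lookup_mult_splits:
  fixes p q :: "('a \<Rightarrow>\<^sub>0 nat) \<Rightarrow>\<^sub>0 'b::semiring_0"
  shows "Poly_Mapping.lookup (p * q) \<alpha> =
    (\<Sum>(\<beta>, \<gamma>)\<in>splits \<alpha>. Poly_Mapping.lookup p \<beta> * Poly_Mapping.lookup q \<gamma>)"
proof -
  have "Poly_Mapping.lookup (p * q) \<alpha> =
      (\<Sum>(\<beta>, \<gamma>). Poly_Mapping.lookup p \<beta> * Poly_Mapping.lookup q \<gamma> when \<alpha> = \<beta> + \<gamma>)"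
    unfolding times_poly_mapping.rep_eq by (rule prod_fun_unfold_prod) simp_all
  also have "\<dots> = (\<Sum>(\<beta>, \<gamma>)\<in>splits \<alpha>. Poly_Mapping.lookup p \<beta> * Poly_Mapping.lookup q \<gamma> when \<alpha> = \<beta> + \<gamma>)"
    by (rule Sum_any.expand_superset[OF finite_splits]) (auto simp: splits_def when_def split: if_splits)
  also have "\<dots> = (\<Sum>(\<beta>, \<gamma>)\<in>splits \<alpha>. Poly_Mapping.lookup p \<beta> * Poly_Mapping.lookup q \<gamma>)"
    by (rule sum.cong) (auto simp: splits_def)
  finally show ?thesis .
qed

lemma minus_add_single:
  "n \<le> Poly_Mapping.lookup \<alpha> i \<Longrightarrow> \<alpha> - Poly_Mapping.single i n + Poly_Mapping.single i n = (\<alpha> :: 'a \<Rightarrow>\<^sub>0 nat)"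
  by (rule poly_mapping_eqI) (auto simp: lookup_add lookup_minus lookup_single when_def)

lemma keys_minus_single_lookup:
  fixes \<alpha> :: "'a \<Rightarrow>\<^sub>0 nat"
  shows "Poly_Mapping.keys (\<alpha> - Poly_Mapping.single i (Poly_Mapping.lookup \<alpha> i)) = Poly_Mapping.keys \<alpha> - {i}"
  by (auto simp: in_keys_iff lookup_minus lookup_single when_def split: if_splits)

text \<open>Multiplication by a monomial shifts coefficients. The case distinction guards against
  the truncated subtraction of exponents.\<close>

lemma lookup_z_var_power_mult:
  "Poly_Mapping.lookup (z_var i ^ m * p) \<alpha> = (if m \<le> Poly_Mapping.lookup \<alpha> i
     then Poly_Mapping.lookup p (\<alpha> - Poly_Mapping.single i m) else 0)"
proof -
  have "z_var i ^ m = Poly_Mapping.single (Poly_Mapping.single i m) 1"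
    by (induction m) (simp_all add: z_var_def mult_single flip: single_add)
  then have eq: "Poly_Mapping.lookup (z_var i ^ m * p) \<alpha> =
      (\<Sum>(\<beta>, \<gamma>)\<in>splits \<alpha>. if \<beta> = Poly_Mapping.single i m then Poly_Mapping.lookup p \<gamma> else 0)"
    by (auto simp: lookup_mult_splits lookup_single when_def intro!: sum.cong)
  show ?thesis
  proof (cases "m \<le> Poly_Mapping.lookup \<alpha> i")
    case True
    then have "(Poly_Mapping.single i m, \<alpha> - Poly_Mapping.single i m) \<in> splits \<alpha>"
      using minus_add_single[OF True] by (simp add: splits_def add.commute)
    then have "(\<Sum>(\<beta>, \<gamma>)\<in>splits \<alpha>. if \<beta> = Poly_Mapping.single i m then Poly_Mapping.lookup p \<gamma> else 0) =
      (\<Sum>(\<beta>, \<gamma>)\<in>{(Poly_Mapping.single i m, \<alpha> - Poly_Mapping.single i m)}.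
        if \<beta> = Poly_Mapping.single i m then Poly_Mapping.lookup p \<gamma> else 0)"
      by (intro sum.mono_neutral_right finite_splits) (auto simp: splits_def split: if_splits)
    then show ?thesis using True eq by simp
  next
    case False
    then have "\<beta> \<noteq> Poly_Mapping.single i m" if "(\<beta>, \<gamma>) \<in> splits \<alpha>" for \<beta> \<gamma>
      using that by (auto simp: splits_def lookup_add)
    then have "(\<Sum>(\<beta>, \<gamma>)\<in>splits \<alpha>. if \<beta> = Poly_Mapping.single i m then Poly_Mapping.lookup p \<gamma> else 0) = 0"
      by (intro sum.neutral) auto
    then show ?thesis using False eq by simp
  qed
qed

text \<open>Every monomial of degree \<open>n\<close> in the variables of \<open>I\<close> occurs
  exactly once in \<open>h_n\<close>. In the induction, the power of the new variable must be its
  full exponent in \<alpha>: anything left over cannot come from the variables in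
  \<open>F\<close>.\<close>

lemma lookup_complete_sym:
  assumes "finite I"
  shows "Poly_Mapping.lookup (complete_sym I n) \<alpha> =
    (if Poly_Mapping.keys \<alpha> \<subseteq> I \<and> (\<Sum>i\<in>I. Poly_Mapping.lookup \<alpha> i) = n then 1 else 0)"
  using assms
proof (induction I arbitrary: n \<alpha> rule: finite_induct)
  case empty
  then show ?case
    by (cases n) (auto simp: complete_sym_def lookup_one when_def)
next
  case (insert i F)
  let ?a = "Poly_Mapping.lookup \<alpha> i"
  let ?\<beta> = "\<alpha> - Poly_Mapping.single i ?a"
  have *: "Poly_Mapping.lookup (complete_sym F (n - m)) (\<alpha> - Poly_Mapping.single i m) = 0"
    if "m < ?a" for m
  proof -
    have "i \<in> Poly_Mapping.keys (\<alpha> - Poly_Mapping.single i m)"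
      using that by (simp add: in_keys_iff lookup_minus)
    then show ?thesis using insert by auto
  qed
  have "complete_sym (insert i F) n = (\<Sum>m=0..n. z_var i ^ m * complete_sym F (n - m))"
    using insert.hyps by (simp add: complete_sym_def fps_mult_nth geometric_fps_def)
  then have "Poly_Mapping.lookup (complete_sym (insert i F) n) \<alpha> =
      (\<Sum>m=0..n. if m \<le> ?a then Poly_Mapping.lookup (complete_sym F (n - m)) (\<alpha> - Poly_Mapping.single i m) else 0)"
    by (simp add: lookup_sum lookup_z_var_power_mult)
  also have "\<dots> = (\<Sum>m=0..n. if m = ?a then Poly_Mapping.lookup (complete_sym F (n - ?a)) ?\<beta> else 0)"
    using * by (intro sum.cong) auto
  also have "\<dots> = (if ?a \<le> n then Poly_Mapping.lookup (complete_sym F (n - ?a)) ?\<beta> else 0)"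
    by simp
  also have "\<dots> = (if Poly_Mapping.keys \<alpha> \<subseteq> insert i F \<and> (\<Sum>i\<in>insert i F. Poly_Mapping.lookup \<alpha> i) = n then 1 else 0)"
  proof -
    have "Poly_Mapping.keys ?\<beta> \<subseteq> F \<longleftrightarrow> Poly_Mapping.keys \<alpha> \<subseteq> insert i F"
      by (auto simp: keys_minus_single_lookup)
    moreover have "(\<Sum>j\<in>F. Poly_Mapping.lookup ?\<beta> j) = (\<Sum>j\<in>F. Poly_Mapping.lookup \<alpha> j)"
      using insert.hyps by (intro sum.cong) (auto simp: lookup_minus lookup_single when_def)
    ultimately show ?thesis using insert by auto
  qed
  finally show ?case .
qed

section \<open>Multiplicativity of the maps in one and in several variables\<close>

lemma sigma_plus_mult: "sigma_plus (u * v) = sigma_plus u * sigma_plus v"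
  and sigma_plus_1: "sigma_plus 1 = 1"
  and sigma_plus_b_vec: "sigma_plus (b_vec j) = Abs_fps (\<lambda>i. b_vec (j + i))"
  using is_sigma_plus_sigma_plus by (simp_all add: is_sigma_plus_def)

lemma sigma_plus_0: "sigma_plus 0 = 0"
  and sigma_plus_sum: "sigma_plus (sum f A) = (\<Sum>x\<in>A. sigma_plus (f x))"
proof -
  interpret Vector_Spaces.linear ext_scale ext_fps_scale sigma_plus
    using is_sigma_plus_sigma_plus by (simp add: is_sigma_plus_def)
  show "sigma_plus 0 = 0" "sigma_plus (sum f A) = (\<Sum>x\<in>A. sigma_plus (f x))"
    by (rule zero, rule sum)
qed

text \<open>Describing the pairs by an addition instead of a truncated subtraction makes the sum in
  \<open>sigma_var\<close> easy to regroup.\<close>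

definition single_splits :: "'a \<Rightarrow> ('a \<Rightarrow>\<^sub>0 nat) \<Rightarrow> (('a \<Rightarrow>\<^sub>0 nat) \<times> nat) set" where
  "single_splits i \<alpha> = {(\<beta>, n). \<beta> + Poly_Mapping.single i n = \<alpha>}"

lemma single_splits_conv:
  "single_splits i \<alpha> = (\<lambda>n. (\<alpha> - Poly_Mapping.single i n, n)) ` {..Poly_Mapping.lookup \<alpha> i}"
  by (auto simp: single_splits_def image_iff minus_add_single lookup_add)

lemma finite_single_splits: "finite (single_splits i \<alpha>)"
  by (simp add: single_splits_conv)

lemma sigma_var_conv:
  "sigma_var i F \<alpha> = (\<Sum>(\<beta>, n)\<in>single_splits i \<alpha>. fps_nth (sigma_plus (F \<beta>)) n)"
  unfolding single_splits_conv
  by (subst sum.reindex) (auto simp: inj_on_def sigma_var_def)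

text \<open>The Cauchy product, with the wedge product on coefficients.\<close>

definition mps_mult :: "ext_mps \<Rightarrow> ext_mps \<Rightarrow> ext_mps" where
  "mps_mult F G = (\<lambda>\<alpha>. \<Sum>(\<beta>, \<gamma>)\<in>splits \<alpha>. F \<beta> * G \<gamma>)"

text \<open>Both sides run over all ways to write \<alpha> as \<beta> + \<gamma> plus the exponents
  \<open>p\<close> and \<open>q\<close> of the \<open>i\<close>-th variable. The left side groups
  \<beta> with \<gamma> and \<open>p\<close> with \<open>q\<close>; the right side groups \<beta>
  with \<open>p\<close> and \<gamma> with \<open>q\<close>.\<close>

lemma sigma_var_mps_mult: "sigma_var i (mps_mult F G) = mps_mult (sigma_var i F) (sigma_var i G)"
proof
  fix \<alpha>
  let ?e = "Poly_Mapping.single i"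
  let ?s = "\<lambda>u n. fps_nth (sigma_plus u) n"
  have "sigma_var i (mps_mult F G) \<alpha> =
      (\<Sum>(\<delta>, n)\<in>single_splits i \<alpha>. \<Sum>(\<beta>, \<gamma>)\<in>splits \<delta>. \<Sum>p\<in>{0..n}. ?s (F \<beta>) p * ?s (G \<gamma>) (n - p))"
    by (simp add: sigma_var_conv mps_mult_def sigma_plus_sum sigma_plus_mult fps_sum_nth
        fps_mult_nth case_prod_unfold)
  also have "\<dots> = (\<Sum>((\<delta>, n), (\<beta>, \<gamma>), p)\<in>(SIGMA x:single_splits i \<alpha>. splits (fst x) \<times> {0..snd x}).
      ?s (F \<beta>) p * ?s (G \<gamma>) (n - p))"
    by (simp add: sum.cartesian_product sum.Sigma finite_single_splits finite_splits case_prod_unfold)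
  also have "\<dots> = (\<Sum>((\<beta>', \<gamma>'), (\<beta>, p), (\<gamma>, q))\<in>(SIGMA x:splits \<alpha>. single_splits i (fst x) \<times> single_splits i (snd x)).
      ?s (F \<beta>) p * ?s (G \<gamma>) q)"
    by (rule sum.reindex_bij_witness[of _
          "\<lambda>((\<beta>', \<gamma>'), (\<beta>, p), (\<gamma>, q)). ((\<beta> + \<gamma>, p + q), (\<beta>, \<gamma>), p)"
          "\<lambda>((\<delta>, n), (\<beta>, \<gamma>), p). ((\<beta> + ?e p, \<gamma> + ?e (n - p)), (\<beta>, p), (\<gamma>, n - p))"])
       (auto simp: splits_def single_splits_def ac_simps simp flip: single_add)
  also have "\<dots> = mps_mult (sigma_var i F) (sigma_var i G) \<alpha>"
    by (simp add: mps_mult_def sigma_var_conv sum_product sum.cartesian_product sum.Sigma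
        finite_single_splits finite_splits case_prod_unfold)
  finally show "sigma_var i (mps_mult F G) \<alpha> = mps_mult (sigma_var i F) (sigma_var i G) \<alpha>" .
qed

lemma mps_const_mult: "mps_const (u * v) = mps_mult (mps_const u) (mps_const v)"
proof
  fix \<alpha> :: "nat \<Rightarrow>\<^sub>0 nat"
  have "mps_mult (mps_const u) (mps_const v) \<alpha> =
      (\<Sum>(\<beta>, \<gamma>)\<in>splits \<alpha> \<inter> {(0, 0)}. mps_const u \<beta> * mps_const v \<gamma>)"
    unfolding mps_mult_def
    by (rule sum.mono_neutral_right) (auto simp: finite_splits mps_const_def split: if_splits)
  also have "\<dots> = mps_const (u * v) \<alpha>"
    by (cases "\<alpha> = 0") (auto simp: splits_def mps_const_def)
  finally show "mps_const (u * v) \<alpha> = mps_mult (mps_const u) (mps_const v) \<alpha>" ..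
qed

lemma sigma_var_1: "sigma_var i (mps_const 1) = mps_const 1"
proof
  fix \<alpha> :: "nat \<Rightarrow>\<^sub>0 nat"
  have "sigma_var i (mps_const 1) \<alpha> =
      (\<Sum>(\<beta>, n)\<in>single_splits i \<alpha> \<inter> {(0, 0)}. fps_nth (sigma_plus (mps_const 1 \<beta>)) n)"
    unfolding sigma_var_conv
    by (rule sum.mono_neutral_right)
       (auto simp: finite_single_splits mps_const_def sigma_plus_0 sigma_plus_1 split: if_splits)
  also have "\<dots> = mps_const 1 \<alpha>"
    by (cases "\<alpha> = 0") (auto simp: single_splits_def mps_const_def sigma_plus_1)
  finally show "sigma_var i (mps_const 1) \<alpha> = mps_const 1 \<alpha>" .
qed

lemma sigma_plus_multi_mult:
  "sigma_plus_multi k (u * v) = mps_mult (sigma_plus_multi k u) (sigma_plus_multi k v)"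
proof -
  have "foldr sigma_var is (mps_const (u * v)) =
      mps_mult (foldr sigma_var is (mps_const u)) (foldr sigma_var is (mps_const v))" for "is"
    by (induction "is") (simp_all add: mps_const_mult sigma_var_mps_mult)
  then show ?thesis by (simp add: sigma_plus_multi_def)
qed

lemma sigma_plus_multi_1: "sigma_plus_multi k 1 = mps_const 1"
proof -
  have "foldr sigma_var is (mps_const 1) = mps_const 1" for "is"
    by (induction "is") (simp_all add: sigma_var_1)
  then show ?thesis by (simp add: sigma_plus_multi_def)
qed

text \<open>Each variable is introduced by exactly one factor, so that factor must supply its whole
  exponent in \<alpha>. The index is therefore raised by the total degree.\<close>

lemma foldr_sigma_var_b_vec:
  assumes "distinct is"
  shows "foldr sigma_var is (mps_const (b_vec j)) \<alpha> =
    (if Poly_Mapping.keys \<alpha> \<subseteq> set is then b_vec (j + (\<Sum>i\<in>set is. Poly_Mapping.lookup \<alpha> i)) else 0)"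
  using assms
proof (induction "is" arbitrary: \<alpha>)
  case Nil
  then show ?case by (simp add: mps_const_def)
next
  case (Cons i "is")
  let ?F = "foldr sigma_var is (mps_const (b_vec j))"
  let ?a = "Poly_Mapping.lookup \<alpha> i"
  let ?\<beta> = "\<alpha> - Poly_Mapping.single i ?a"
  have *: "?F (\<alpha> - Poly_Mapping.single i n) = 0" if "n < ?a" for n
  proof -
    have "i \<in> Poly_Mapping.keys (\<alpha> - Poly_Mapping.single i n)"
      using that by (simp add: in_keys_iff lookup_minus)
    then show ?thesis using Cons by auto
  qed
  have "foldr sigma_var (i # is) (mps_const (b_vec j)) \<alpha> =
      (\<Sum>n\<le>?a. fps_nth (sigma_plus (?F (\<alpha> - Poly_Mapping.single i n))) n)"
    by (simp add: sigma_var_def)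
  also have "\<dots> = (\<Sum>n\<in>{?a}. fps_nth (sigma_plus (?F (\<alpha> - Poly_Mapping.single i n))) n)"
    using * by (intro sum.mono_neutral_right) (auto simp: sigma_plus_0)
  also have "\<dots> = fps_nth (sigma_plus (?F ?\<beta>)) ?a" by simp
  also have "\<dots> = (if Poly_Mapping.keys \<alpha> \<subseteq> insert i (set is)
      then b_vec (j + (\<Sum>i\<in>insert i (set is). Poly_Mapping.lookup \<alpha> i)) else 0)"
  proof -
    have "Poly_Mapping.keys ?\<beta> \<subseteq> set is \<longleftrightarrow> Poly_Mapping.keys \<alpha> \<subseteq> insert i (set is)"
      by (auto simp: keys_minus_single_lookup)
    moreover have "(\<Sum>l\<in>set is. Poly_Mapping.lookup ?\<beta> l) = (\<Sum>l\<in>set is. Poly_Mapping.lookup \<alpha> l)"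
      using Cons.prems by (intro sum.cong) (auto simp: lookup_minus lookup_single when_def)
    ultimately show ?thesis using Cons by (simp add: sigma_plus_0 sigma_plus_b_vec ac_simps)
  qed
  finally show ?case by simp
qed

text \<open>Only \<open>m = j + ?d\<close> can contribute, by homogeneity of \<open>h_(m-j)\<close>.
  Writing this single term as a sum over a range that does not depend on \<alpha> prepares the
  expansion of products.\<close>

lemma sigma_plus_multi_b_vec:
  assumes "j + (\<Sum>i<k. Poly_Mapping.lookup \<alpha> i) \<le> M"
  shows "sigma_plus_multi k (b_vec j) \<alpha> =
    (\<Sum>m\<le>M. ext_scale (Poly_Mapping.lookup (complete_sym_diff {..<k} m j) \<alpha>) (b_vec m))"
proof -
  let ?d = "\<Sum>i<k. Poly_Mapping.lookup \<alpha> i"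
  have "(\<Sum>m\<le>M. ext_scale (Poly_Mapping.lookup (complete_sym_diff {..<k} m j) \<alpha>) (b_vec m)) =
    (\<Sum>m\<in>{j + ?d}. ext_scale (Poly_Mapping.lookup (complete_sym_diff {..<k} m j) \<alpha>) (b_vec m))"
    using assms
    by (intro sum.mono_neutral_right) (auto simp: complete_sym_diff_def lookup_complete_sym)
  also have "\<dots> = sigma_plus_multi k (b_vec j) \<alpha>"
    by (simp add: sigma_plus_multi_def foldr_sigma_var_b_vec complete_sym_diff_def
        lookup_complete_sym atLeast0LessThan)
  finally show ?thesis ..
qed

lemma ext_scale_mult: "ext_scale c u * ext_scale d v = ext_scale (c * d) (u * v)"
  by (metis (no_types, lifting) ext_of_rat_commute ext_of_rat_simps(2) ext_scale_def mult.assoc)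

text \<open>The coefficient of the word \<open>ms\<close> in the expansion of the image of the word
  \<open>js\<close>, each letter being raised separately.\<close>

definition shift_coeff :: "nat \<Rightarrow> nat list \<Rightarrow> nat list \<Rightarrow> mpoly_rat" where
  "shift_coeff k ms js = prod_list (map2 (complete_sym_diff {..<k}) ms js)"

text \<open>Multiplicativity and distributivity, one letter at a time. The words \<open>ms\<close>
  are not yet sorted and may repeat letters.\<close>

lemma sigma_plus_multi_prod_list:
  assumes "\<forall>j\<in>set js. j + (\<Sum>i<k. Poly_Mapping.lookup \<alpha> i) \<le> M"
  shows "sigma_plus_multi k (prod_list (map b_vec js)) \<alpha> =
    (\<Sum>ms | set ms \<subseteq> {..M} \<and> length ms = length js.
      ext_scale (Poly_Mapping.lookup (shift_coeff k ms js) \<alpha>) (prod_list (map b_vec ms)))"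
  using assms
proof (induction js arbitrary: \<alpha>)
  case Nil
  have "{ms. set ms \<subseteq> {..M} \<and> length ms = 0} = {[]}" by auto
  then show ?case
    by (simp add: sigma_plus_multi_1 mps_const_def shift_coeff_def lookup_one when_def
        extv.scale_one)
next
  case (Cons j js)
  let ?L = "\<lambda>n. {ms. set ms \<subseteq> {..M} \<and> length ms = n}"
  let ?c = "\<lambda>m \<beta>. Poly_Mapping.lookup (complete_sym_diff {..<k} m j) \<beta>"
  let ?C = "\<lambda>ms \<gamma>. Poly_Mapping.lookup (shift_coeff k ms js) \<gamma>"
  let ?B = "\<lambda>ms. prod_list (map b_vec ms)"
  have split: "sigma_plus_multi k (b_vec j) \<beta> = (\<Sum>m\<le>M. ext_scale (?c m \<beta>) (b_vec m))"
    "sigma_plus_multi k (?B js) \<gamma> = (\<Sum>ms\<in>?L (length js). ext_scale (?C ms \<gamma>) (?B ms))"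
    if "(\<beta>, \<gamma>) \<in> splits \<alpha>" for \<beta> \<gamma>
  proof -
    \<comment> \<open>Degrees add up over a splitting, so the bound \<open>M\<close> for \<alpha>
      also serves both parts.\<close>
    have le: "(\<Sum>i<k. Poly_Mapping.lookup \<beta> i) + (\<Sum>i<k. Poly_Mapping.lookup \<gamma> i) =
        (\<Sum>i<k. Poly_Mapping.lookup \<alpha> i)"
      using that by (auto simp: splits_def lookup_add sum.distrib)
    show "sigma_plus_multi k (b_vec j) \<beta> = (\<Sum>m\<le>M. ext_scale (?c m \<beta>) (b_vec m))"
      using Cons.prems le by (intro sigma_plus_multi_b_vec) simp
    show "sigma_plus_multi k (?B js) \<gamma> = (\<Sum>ms\<in>?L (length js). ext_scale (?C ms \<gamma>) (?B ms))"
      using Cons.prems le by (intro Cons.IH) auto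
  qed
  have "sigma_plus_multi k (?B (j # js)) \<alpha> =
      (\<Sum>(\<beta>, \<gamma>)\<in>splits \<alpha>. sigma_plus_multi k (b_vec j) \<beta> * sigma_plus_multi k (?B js) \<gamma>)"
    by (simp add: sigma_plus_multi_mult mps_mult_def)
  also have "\<dots> = (\<Sum>x\<in>splits \<alpha>. \<Sum>y\<in>?L (length js) \<times> {..M}.
      ext_scale (?c (snd y) (fst x) * ?C (fst y) (snd x)) (?B (snd y # fst y)))"
  proof (rule sum.cong[OF refl], clarify)
    fix \<beta> \<gamma> assume "(\<beta>, \<gamma>) \<in> splits \<alpha>"
    then have "sigma_plus_multi k (b_vec j) \<beta> * sigma_plus_multi k (?B js) \<gamma> =
      (\<Sum>m\<le>M. \<Sum>ms\<in>?L (length js). ext_scale (?c m \<beta> * ?C ms \<gamma>) (?B (m # ms)))"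
      by (simp only: split sum_product ext_scale_mult list.map prod_list.Cons)
    \<comment> \<open>Tails come before heads here, as in the enumeration of longer lists used for
      the last reindexing.\<close>
    also have "\<dots> = (\<Sum>ms\<in>?L (length js). \<Sum>m\<le>M. ext_scale (?c m \<beta> * ?C ms \<gamma>) (?B (m # ms)))"
      by (rule sum.swap)
    finally show "sigma_plus_multi k (b_vec j) \<beta> * sigma_plus_multi k (?B js) \<gamma> =
      (\<Sum>y\<in>?L (length js) \<times> {..M}. ext_scale (?c (snd y) (fst (\<beta>, \<gamma>)) * ?C (fst y) (snd (\<beta>, \<gamma>)))
        (?B (snd y # fst y)))"
      by (simp add: sum.cartesian_product case_prod_unfold)
  qed
  \<comment> \<open>Summing over the splittings first turns the convolution into one coefficient of
    the product of the two polynomials.\<close>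
  also have "\<dots> = (\<Sum>y\<in>?L (length js) \<times> {..M}.
      ext_scale (Poly_Mapping.lookup (shift_coeff k (snd y # fst y) (j # js)) \<alpha>) (?B (snd y # fst y)))"
    by (subst sum.swap)
       (simp add: shift_coeff_def lookup_mult_splits case_prod_unfold extv.scale_sum_left)
  also have "\<dots> = (\<Sum>ms\<in>?L (length (j # js)).
      ext_scale (Poly_Mapping.lookup (shift_coeff k ms (j # js)) \<alpha>) (?B ms))"
  proof -
    have "?L (length (j # js)) = (\<lambda>y. snd y # fst y) ` (?L (length js) \<times> {..M})"
      using lists_length_Suc_eq[of "{..M}" "length js"] by (simp add: case_prod_unfold)
    moreover have "inj_on (\<lambda>y. snd y # fst y) (?L (length js) \<times> {..M})"
      by (auto simp: inj_on_def)
    ultimately show ?thesis by (simp only: sum.reindex o_def)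
  qed
  finally show ?case .
qed

section \<open>Antisymmetrization\<close>

text \<open>Each factor that \<open>x\<close> passes contributes one sign.\<close>

lemma ext_deg1_commute_prod_list:
  assumes "x \<in> ext_deg1" "set vs \<subseteq> ext_deg1"
  shows "x * prod_list vs = (-1) ^ length vs * (prod_list vs * x)"
  using assms(2)
proof (induction vs)
  case (Cons v vs)
  have "x * prod_list (v # vs) = - (v * (x * prod_list vs))"
    using ext_deg1_anticommute[of x v] assms(1) Cons.prems by (simp flip: mult.assoc)
  also have "\<dots> = - (v * (-1) ^ length vs * (prod_list vs * x))"
    using Cons by (simp add: mult.assoc)
  also have "v * (-1) ^ length vs = (-1) ^ length vs * v"
    by (cases "even (length vs)") auto
  finally show ?case by (simp add: mult.assoc)
qed simp

text \<open>Moving \<open>x\<close>, or \<open>y\<close>, past \<open>vs\<close> costs the same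
  sign, so the two signs agree and only \<open>x * y = - (y * x)\<close> remains.\<close>

lemma ext_deg1_swap:
  assumes "x \<in> ext_deg1" "y \<in> ext_deg1" "set vs \<subseteq> ext_deg1"
  shows "x * prod_list vs * y = - (y * prod_list vs * x)"
proof -
  let ?V = "prod_list vs" and ?s = "(-1 :: ext) ^ length vs"
  have "x * ?V * y = ?s * (?V * (x * y))"
    using ext_deg1_commute_prod_list[OF assms(1,3)] by (simp add: mult.assoc)
  also have "x * y = - (y * x)"
    by (rule ext_deg1_anticommute[OF assms(1,2)])
  also have "?s * (?V * - (y * x)) = - (y * ?V * x)"
    using ext_deg1_commute_prod_list[OF assms(2,3)] by (simp add: mult.assoc)
  finally show ?thesis .
qed

text \<open>The first copy of a repeated factor is moved next to the second, where their square
  vanishes.\<close>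

lemma prod_list_ext_deg1_not_distinct:
  assumes "set xs \<subseteq> ext_deg1" "\<not> distinct xs"
  shows "prod_list xs = 0"
proof -
  obtain us x vs ws where xs: "xs = us @ [x] @ vs @ [x] @ ws"
    using not_distinct_decomp[OF assms(2)] by blast
  have "x * prod_list vs * x = (-1) ^ length vs * (prod_list vs * (x * x))"
    using ext_deg1_commute_prod_list[of x vs] assms(1) xs by (simp add: mult.assoc)
  also have "x * x = 0" using ext_deg1_square[of x] assms(1) xs by simp
  finally have "x * prod_list vs * x = 0" by simp
  then have "prod_list us * (x * prod_list vs * x) * prod_list ws = 0" by simp
  then show ?thesis using xs by (simp add: mult.assoc)
qed

text \<open>The positions need not be adjacent: the block between them is handled by
  \<open>ext_deg1_swap\<close>, and the outer blocks are common factors.\<close>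

lemma prod_list_permute_transpose:
  assumes "set xs \<subseteq> ext_deg1" "a < b" "b < length xs"
  shows "prod_list (permute_list (Transposition.transpose a b) xs) = - prod_list xs"
proof -
  define us vs ws where "us = take a xs" and "vs = take (b - Suc a) (drop (Suc a) xs)"
    and "ws = drop (Suc b) xs"
  let ?x = "xs ! a" and ?y = "xs ! b"
  have xs: "xs = us @ [?x] @ vs @ [?y] @ ws"
  proof -
    have "drop (Suc a) xs = vs @ drop (b - Suc a) (drop (Suc a) xs)"
      unfolding vs_def by (rule append_take_drop_id[symmetric])
    also have "drop (b - Suc a) (drop (Suc a) xs) = ?y # ws"
      using assms by (simp add: ws_def Cons_nth_drop_Suc)
    finally show ?thesis
      using assms id_take_nth_drop[of a xs] by (simp add: us_def)
  qed
  have len: "length us = a" "length vs = b - Suc a"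
    using assms by (auto simp: us_def vs_def)
  have "permute_list (Transposition.transpose a b) xs = us @ [?y] @ vs @ [?x] @ ws"
  proof (rule nth_equalityI)
    show "length (permute_list (Transposition.transpose a b) xs) = length (us @ [?y] @ vs @ [?x] @ ws)"
      by (subst xs) simp
    fix i assume "i < length (permute_list (Transposition.transpose a b) xs)"
    then have i: "i < length xs" by simp
    have "permute_list (Transposition.transpose a b) xs ! i = xs ! Transposition.transpose a b i"
      using i by (simp add: permute_list_def)
    also have "\<dots> = (us @ [?y] @ vs @ [?x] @ ws) ! i"
    proof (cases "i = a \<or> i = b")
      case True
      then show ?thesis using assms len by (auto simp: nth_append)
    next
      case False
      then have "(us @ [?y] @ vs @ [?x] @ ws) ! i = (us @ [?x] @ vs @ [?y] @ ws) ! i"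
        using assms len by (auto simp: nth_append nth_Cons split: nat.splits)
      then show ?thesis using False xs by (simp add: transpose_apply_other)
    qed
    finally show "permute_list (Transposition.transpose a b) xs ! i = (us @ [?y] @ vs @ [?x] @ ws) ! i" .
  qed
  moreover have "set vs \<subseteq> ext_deg1"
    using assms(1) set_take_subset set_drop_subset unfolding vs_def by fastforce
  then have "?y * prod_list vs * ?x = - (?x * prod_list vs * ?y)"
    using assms by (intro ext_deg1_swap) auto
  then have "prod_list us * (?y * prod_list vs * ?x) * prod_list ws =
      - (prod_list us * (?x * prod_list vs * ?y) * prod_list ws)"
    by simp
  moreover have "prod_list xs = prod_list us * (?x * prod_list vs * ?y) * prod_list ws"
    using arg_cong[OF xs, of prod_list] by (simp add: mult.assoc)
  ultimately show ?thesis by (simp add: mult.assoc)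
qed

text \<open>Induction along a decomposition into transpositions, each of which reverses both the
  sign of the product and that of the permutation.\<close>

lemma prod_list_permute_list:
  assumes "p permutes {..<length xs}" "set xs \<subseteq> ext_deg1"
  shows "prod_list (permute_list p xs) = of_int (sign p) * prod_list xs"
  using finite_lessThan assms(1)
proof (induction rule: permutes_rev_induct)
  case (swap a b p)
  let ?t = "Transposition.transpose a b"
  have t: "?t permutes {..<length xs}"
    using swap by (intro permutes_swap_id) auto
  have set: "set (permute_list p xs) \<subseteq> ext_deg1"
    using swap assms(2) by simp
  have "permute_list (p \<circ> ?t) xs = permute_list ?t (permute_list p xs)"
    by (rule permute_list_compose[OF t])
  also have "prod_list \<dots> = - prod_list (permute_list p xs)"
  proof (cases "a < b")
    case True
    then show ?thesis using swap set by (intro prod_list_permute_transpose) auto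
  next
    case False
    then show ?thesis
      using swap set prod_list_permute_transpose[of "permute_list p xs" b a]
      by (simp add: transpose_commute)
  qed
  also have "\<dots> = of_int (sign (p \<circ> ?t)) * prod_list xs"
  proof -
    have "sign (p \<circ> ?t) = - sign p"
      using swap permutation_swap_id[of a b] permutation_permutes[of p]
      by (auto simp: sign_compose sign_swap_id)
    then show ?thesis using swap by simp
  qed
  finally show ?case .
qed simp

lemma b_vec_ext_deg1: "b_vec j \<in> ext_deg1"
  using ext_scale_b_vec[of 1 j] by (simp add: extv.scale_one)

text \<open>Sorting recovers the decreasing list from any rearrangement, and distinctness of its
  entries then determines the permutation. So each distinct list arises from exactly one
  pair.\<close>

lemma sum_distinct_lists_conv_permute_list:
  fixes f :: "'a::linorder list \<Rightarrow> 'b::comm_monoid_add"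
  shows "(\<Sum>ms | set ms \<subseteq> A \<and> length ms = k \<and> distinct ms. f ms) =
    (\<Sum>(\<rho>, p)\<in>{\<rho>. set \<rho> \<subseteq> A \<and> length \<rho> = k \<and> sorted_wrt (>) \<rho>} \<times> {p. p permutes {..<k}}.
      f (permute_list p \<rho>))"
proof -
  let ?D = "{\<rho>. set \<rho> \<subseteq> A \<and> length \<rho> = k \<and> sorted_wrt (>) \<rho>}" and ?P = "{p. p permutes {..<k}}"
  have rev: "sorted_wrt (<) (rev \<rho>)" if "sorted_wrt (>) \<rho>" for \<rho> :: "'a list"
    using that by (simp add: sorted_wrt_rev)
  have dist: "distinct \<rho>" if "sorted_wrt (>) \<rho>" for \<rho> :: "'a list"
    using rev[OF that] by (simp add: strict_sorted_iff)
  have "bij_betw (\<lambda>(\<rho>, p). permute_list p \<rho>) (?D \<times> ?P)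
      {ms. set ms \<subseteq> A \<and> length ms = k \<and> distinct ms}"
  proof (rule bij_betw_imageI)
    show "inj_on (\<lambda>(\<rho>, p). permute_list p \<rho>) (?D \<times> ?P)"
    proof (rule inj_onI, clarify)
      fix \<rho> \<rho>' :: "'a list" and p q
      assume *: "p permutes {..<length \<rho>}" "q permutes {..<length \<rho>}" "length \<rho>' = length \<rho>"
        "sorted_wrt (>) \<rho>" "sorted_wrt (>) \<rho>'" "permute_list p \<rho> = permute_list q \<rho>'"
      then have "set \<rho> = set \<rho>'" by (metis set_permute_list)
      then have "rev \<rho> = rev \<rho>'"
        using strict_sorted_equal[OF rev[OF *(4)] rev[OF *(5)]] by simp
      then have \<rho>: "\<rho> = \<rho>'" by simp
      have "p i = q i" for i
      proof (cases "i < length \<rho>")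
        case True
        have "\<rho> ! p i = \<rho> ! q i"
          using *(1,2,6) True \<rho> by (metis permute_list_nth)
        moreover have "p i < length \<rho>" "q i < length \<rho>"
          using permutes_in_image[OF *(1), of i] permutes_in_image[OF *(2), of i] True by auto
        ultimately show ?thesis using dist[OF *(4)] nth_eq_iff_index_eq by blast
      next
        case False
        then show ?thesis using permutes_not_in[OF *(1)] permutes_not_in[OF *(2)] by simp
      qed
      with \<rho> show "\<rho> = \<rho>' \<and> p = q" by blast
    qed
    show "(\<lambda>(\<rho>, p). permute_list p \<rho>) ` (?D \<times> ?P) = {ms. set ms \<subseteq> A \<and> length ms = k \<and> distinct ms}"
    proof (intro equalityI subsetI)
      fix ms assume "ms \<in> (\<lambda>(\<rho>, p). permute_list p \<rho>) ` (?D \<times> ?P)"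
      then show "ms \<in> {ms. set ms \<subseteq> A \<and> length ms = k \<and> distinct ms}"
        by (auto simp: dist)
    next
      fix ms assume ms: "ms \<in> {ms. set ms \<subseteq> A \<and> length ms = k \<and> distinct ms}"
      let ?\<rho> = "rev (sort ms)"
      have "mset ms = mset ?\<rho>" by simp
      then obtain p where "p permutes {..<length ?\<rho>}" "permute_list p ?\<rho> = ms"
        by (rule mset_eq_permutation)
      moreover have "sorted_wrt (<) (sort ms)"
        using ms by (simp add: strict_sorted_iff)
      then have "?\<rho> \<in> ?D" using ms by (simp add: sorted_wrt_rev)
      ultimately show "ms \<in> (\<lambda>(\<rho>, p). permute_list p \<rho>) ` (?D \<times> ?P)"
        using ms by (intro image_eqI[of _ _ "(?\<rho>, p)"]) auto
    qed
  qed
  from sum.reindex_bij_betw[OF this, of f] show ?thesis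
    by (simp add: case_prod_unfold)
qed

section \<open>Partitions and strictly decreasing index lists\<close>

definition beta_list :: "nat \<Rightarrow> nat list \<Rightarrow> nat list" where
  "beta_list k \<mu> = map (\<lambda>i. k - 1 - i + \<mu> ! i) [0..<k]"

lemma b_wedge_conv: "b_wedge k \<mu> = prod_list (map b_vec (beta_list k \<mu>))"
  by (simp add: b_wedge_def beta_list_def o_def)

text \<open>Adding the staircase \<open>k - 1, ..., 0\<close> makes a weakly decreasing list
  strictly decreasing, and subtracting it is the inverse.\<close>

lemma bij_betw_beta_list:
  "bij_betw (beta_list k) (partitions k) {\<rho>. length \<rho> = k \<and> sorted_wrt (>) \<rho>}"
proof (rule bij_betwI[where g = "\<lambda>\<rho>. map (\<lambda>i. \<rho> ! i - (k - 1 - i)) [0..<k]"])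
  \<comment> \<open>The list still drops by at least one at each of the \<open>k - 1 - i\<close>
    steps after position \<open>i\<close>. Hence subtracting the staircase is never
    truncated.\<close>
  have ge: "k - 1 - i \<le> \<rho> ! i" if "sorted_wrt (>) \<rho>" "length \<rho> = k" "i < k" for \<rho> i
    using that(3)
  proof (induction "k - 1 - i" arbitrary: i)
    case (Suc d)
    then have i: "Suc i < k" "d = k - 1 - Suc i" by auto
    then have "d \<le> \<rho> ! Suc i" using Suc.hyps(1)[of "Suc i"] by simp
    moreover have "\<rho> ! Suc i < \<rho> ! i"
      using that(1,2) i by (simp add: sorted_wrt_iff_nth_less)
    ultimately show ?case using Suc.hyps(2) by linarith
  qed simp
  show "beta_list k \<in> partitions k \<rightarrow> {\<rho>. length \<rho> = k \<and> sorted_wrt (>) \<rho>}"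
  proof
    fix \<mu> assume \<mu>: "\<mu> \<in> partitions k"
    have "k - 1 - j + \<mu> ! j < k - 1 - i + \<mu> ! i" if "i < j" "j < k" for i j
    proof -
      have "\<mu> ! j \<le> \<mu> ! i"
        using \<mu> that by (simp add: partitions_def sorted_wrt_iff_nth_less)
      then show ?thesis using that by linarith
    qed
    then show "beta_list k \<mu> \<in> {\<rho>. length \<rho> = k \<and> sorted_wrt (>) \<rho>}"
      by (simp add: beta_list_def sorted_wrt_iff_nth_less)
  qed
  show "(\<lambda>\<rho>. map (\<lambda>i. \<rho> ! i - (k - 1 - i)) [0..<k]) \<in>
      {\<rho>. length \<rho> = k \<and> sorted_wrt (>) \<rho>} \<rightarrow> partitions k"
  proof clarify
    fix \<rho> :: "nat list" assume k: "k = length \<rho>" and \<rho>: "sorted_wrt (>) \<rho>"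
    \<comment> \<open>Between neighbours the staircase falls by exactly one and the list by at least
      one; longer distances follow by induction.\<close>
    have "\<rho> ! j - (k - 1 - j) \<le> \<rho> ! i - (k - 1 - i)" if "i < j" "j < k" for i j
      using that
    proof (induction j rule: less_induct)
      case (less j)
      then obtain j' where j: "j = Suc j'" by (cases j) auto
      have "\<rho> ! j < \<rho> ! j'"
        using k \<rho> less.prems j by (simp add: sorted_wrt_iff_nth_less)
      then have "\<rho> ! j - (k - 1 - j) \<le> \<rho> ! j' - (k - 1 - j')"
        using less.prems j by linarith
      then show ?case using less.IH[of j'] less.prems j by (cases "i = j'") auto
    qed
    then show "map (\<lambda>i. \<rho> ! i - (length \<rho> - 1 - i)) [0..<length \<rho>] \<in> partitions (length \<rho>)"
      using k by (simp add: partitions_def sorted_wrt_iff_nth_less)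
  qed
  show "map (\<lambda>i. beta_list k \<mu> ! i - (k - 1 - i)) [0..<k] = \<mu>" if "\<mu> \<in> partitions k" for \<mu>
    using that by (intro nth_equalityI) (auto simp: beta_list_def partitions_def)
  show "beta_list k (map (\<lambda>i. \<rho> ! i - (k - 1 - i)) [0..<k]) = \<rho>"
    if "\<rho> \<in> {\<rho>. length \<rho> = k \<and> sorted_wrt (>) \<rho>}" for \<rho>
  proof (rule nth_equalityI)
    fix i assume "i < length (beta_list k (map (\<lambda>i. \<rho> ! i - (k - 1 - i)) [0..<k]))"
    then have i: "i < k" by (simp add: beta_list_def)
    then have "beta_list k (map (\<lambda>i. \<rho> ! i - (k - 1 - i)) [0..<k]) ! i =
        k - 1 - i + (\<rho> ! i - (k - 1 - i))"
      by (simp add: beta_list_def)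
    also have "\<dots> = \<rho> ! i"
      using that i by (intro le_add_diff_inverse ge) auto
    finally show "beta_list k (map (\<lambda>i. \<rho> ! i - (k - 1 - i)) [0..<k]) ! i = \<rho> ! i" .
  qed (use that in \<open>simp add: beta_list_def\<close>)
qed

section \<open>Schur polynomials as signed sums of shift coefficients\<close>

lemma shift_coeff_staircase:
  assumes "length ms = k"
  shows "shift_coeff k ms (map (\<lambda>i. k - 1 - i) [0..<k]) =
    (\<Prod>i<k. complete_sym_diff {..<k} (ms ! i) (k - 1 - i))"
  using assms by (simp add: shift_coeff_def prod.list_conv_set_nth atLeast0LessThan)

text \<open>Every monomial of \<open>h_n\<close> has degree \<open>n\<close> in the variables of
  \<open>I\<close>, and a further factor cannot lower this degree.\<close>

lemma lookup_complete_sym_mult_eq_0: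
  assumes "finite I" "(\<Sum>i\<in>I. Poly_Mapping.lookup \<alpha> i) < n"
  shows "Poly_Mapping.lookup (complete_sym I n * q) \<alpha> = 0"
proof -
  have "(\<Sum>i\<in>I. Poly_Mapping.lookup \<beta> i) \<noteq> n" if "(\<beta>, \<gamma>) \<in> splits \<alpha>" for \<beta> \<gamma>
    using that assms(2) by (auto simp: splits_def lookup_add sum.distrib)
  then show ?thesis
    unfolding lookup_mult_splits using assms(1)
    by (intro sum.neutral) (auto simp: lookup_complete_sym)
qed

text \<open>Staircase entries are at most \<open>k - 1\<close>, so an entry of \<open>ms\<close>
  above \<open>M\<close> yields a factor \<open>h_n\<close> with \<open>n\<close> larger than the
  degree of \<alpha>. This justifies truncation at \<open>M\<close>.\<close>

lemma lookup_shift_coeff_staircase_eq_0: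
  assumes "length ms = k" "\<not> set ms \<subseteq> {..M}" "k - 1 + (\<Sum>i<k. Poly_Mapping.lookup \<alpha> i) \<le> M"
  shows "Poly_Mapping.lookup (shift_coeff k ms (map (\<lambda>i. k - 1 - i) [0..<k])) \<alpha> = 0"
proof -
  obtain x where "x \<in> set ms" "M < x"
    using assms(2) by (metis atMost_iff not_le subsetI)
  then obtain i where i: "i < k" "M < ms ! i"
    using assms(1) by (metis in_set_conv_nth)
  have "shift_coeff k ms (map (\<lambda>i. k - 1 - i) [0..<k]) =
      complete_sym_diff {..<k} (ms ! i) (k - 1 - i) *
      (\<Prod>i\<in>{..<k} - {i}. complete_sym_diff {..<k} (ms ! i) (k - 1 - i))"
    unfolding shift_coeff_staircase[OF assms(1)] using i by (intro prod.remove) auto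
  moreover have "complete_sym_diff {..<k} (ms ! i) (k - 1 - i) = complete_sym {..<k} (ms ! i - (k - 1 - i))"
    using i assms(3) by (simp add: complete_sym_diff_def)
  moreover have "(\<Sum>i<k. Poly_Mapping.lookup \<alpha> i) < ms ! i - (k - 1 - i)"
    using i assms(3) by linarith
  ultimately show ?thesis by (simp add: lookup_complete_sym_mult_eq_0)
qed

text \<open>The Leibniz expansion of the Jacobi--Trudi determinant, once both indices are reversed
  so that rows follow \<open>beta_list\<close> and columns follow the staircase.\<close>

lemma schur_conv_shift_coeff:
  "schur k \<mu> = (\<Sum>p | p permutes {..<k}. of_int (sign p) *
    shift_coeff k (permute_list p (beta_list k \<mu>)) (map (\<lambda>i. k - 1 - i) [0..<k]))"
proof -
  let ?A = "mat k k (\<lambda>(j, i). complete_sym_diff {..<k} (beta_list k \<mu> ! j) (k - 1 - i))"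
  have "schur k \<mu> = det (mat k k (\<lambda>(i, j). ?A $$ (k - 1 - i, k - 1 - j)))"
    unfolding jacobi_trudi
    by (intro arg_cong[of _ _ det] eq_matI) (auto simp: beta_list_def add.commute)
  also have "\<dots> = det ?A" by (rule det_reverse) simp
  \<comment> \<open>The expansion by columns puts \<open>p\<close> on the row index, just as
    \<open>permute_list\<close> does on the list.\<close>
  also have "\<dots> = (\<Sum>p | p permutes {0..<k}. signof p * (\<Prod>i<k. ?A $$ (p i, i)))"
    by (rule det_col) simp
  also have "\<dots> = (\<Sum>p | p permutes {..<k}. of_int (sign p) *
      shift_coeff k (permute_list p (beta_list k \<mu>)) (map (\<lambda>i. k - 1 - i) [0..<k]))"
  proof (intro sum.cong)
    fix p assume "p \<in> {p. p permutes {..<k}}"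
    then have p: "p permutes {..<k}" by simp
    have "p i < k" if "i < k" for i using permutes_in_image[OF p, of i] that by simp
    moreover have len: "length (beta_list k \<mu>) = k" by (simp add: beta_list_def)
    moreover have "shift_coeff k (permute_list p (beta_list k \<mu>)) (map (\<lambda>i. k - 1 - i) [0..<k]) =
        (\<Prod>i<k. complete_sym_diff {..<k} (permute_list p (beta_list k \<mu>) ! i) (k - 1 - i))"
      by (rule shift_coeff_staircase) (simp add: len)
    ultimately show "of_int (sign p) * (\<Prod>i<k. ?A $$ (p i, i)) = of_int (sign p) *
      shift_coeff k (permute_list p (beta_list k \<mu>)) (map (\<lambda>i. k - 1 - i) [0..<k])"
      using p by (simp add: permute_list_nth)
  qed (simp_all add: atLeast0LessThan)
  finally show ?thesis .
qed

text \<open>Sorting the wedge factors produces the sign of \<open>p\<close>; moved to the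
  coefficient, it is the sign in the determinant.\<close>

lemma sum_permute_list_beta_list:
  "(\<Sum>p | p permutes {..<k}.
     ext_scale (Poly_Mapping.lookup
         (shift_coeff k (permute_list p (beta_list k \<mu>)) (map (\<lambda>i. k - 1 - i) [0..<k])) \<alpha>)
       (prod_list (map b_vec (permute_list p (beta_list k \<mu>))))) =
   mpoly_scale (schur k \<mu>) (b_wedge k \<mu>) \<alpha>"
proof -
  let ?C = "\<lambda>p. shift_coeff k (permute_list p (beta_list k \<mu>)) (map (\<lambda>i. k - 1 - i) [0..<k])"
  have "ext_scale (Poly_Mapping.lookup (?C p) \<alpha>) (prod_list (map b_vec (permute_list p (beta_list k \<mu>)))) =
      ext_scale (Poly_Mapping.lookup (of_int (sign p) * ?C p) \<alpha>) (b_wedge k \<mu>)"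
    if "p permutes {..<k}" for p
  proof -
    have p: "p permutes {..<length (beta_list k \<mu>)}" using that by (simp add: beta_list_def)
    have "prod_list (map b_vec (permute_list p (beta_list k \<mu>))) = of_int (sign p) * b_wedge k \<mu>"
      using prod_list_permute_list[of p "map b_vec (beta_list k \<mu>)"] p b_vec_ext_deg1
      by (auto simp: permute_list_map[OF p] b_wedge_conv)
    then show ?thesis
      by (cases p rule: sign_cases)
         (simp_all add: extv.scale_minus_left extv.scale_minus_right)
  qed
  then show ?thesis
    by (simp add: mpoly_scale_def schur_conv_shift_coeff lookup_sum extv.scale_sum_left)
qed

section \<open>Comparison of coefficients\<close>

theorem lemma7p2:
  fixes k :: nat
  assumes "k \<ge> 1"
  shows "has_formal_sum (\<lambda>\<mu>. mpoly_scale (schur k \<mu>) (b_wedge k \<mu>)) (partitions k)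
           (sigma_plus_multi k (b_wedge k (replicate k 0)))"
  unfolding has_formal_sum_def
proof
  fix \<alpha> :: "nat \<Rightarrow>\<^sub>0 nat"
  \<comment> \<open>The largest index in the initial wedge product plus the degree of \<alpha>: no
    larger index can occur in this coefficient.\<close>
  define M where "M = k - 1 + (\<Sum>i<k. Poly_Mapping.lookup \<alpha> i)"
  define js where "js = map (\<lambda>i. k - 1 - i) [0..<k]"
  define T where "T \<mu> = mpoly_scale (schur k \<mu>) (b_wedge k \<mu>) \<alpha>" for \<mu>
  define f where "f ms = ext_scale (Poly_Mapping.lookup (shift_coeff k ms js) \<alpha>)
    (prod_list (map b_vec ms))" for ms
  \<comment> \<open>A finite set of partitions that contains all those contributing at
    \<alpha>.\<close>
  define A where "A = {\<mu> \<in> partitions k. set (beta_list k \<mu>) \<subseteq> {..M}}"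
  define D where "D = {\<rho>. set \<rho> \<subseteq> {..M} \<and> length \<rho> = k \<and> sorted_wrt (>) \<rho>}"
  have T: "T \<mu> = (\<Sum>p | p permutes {..<k}. f (permute_list p (beta_list k \<mu>)))" for \<mu>
    unfolding T_def f_def js_def by (rule sum_permute_list_beta_list[symmetric])
  have fin: "finite {ms. set ms \<subseteq> {..M} \<and> length ms = k}"
    by (simp add: finite_lists_length_eq)
  have finD: "finite D"
    by (rule finite_subset[OF _ fin]) (auto simp: D_def)
  have bij: "bij_betw (beta_list k) A D"
  proof (rule bij_betw_subset[OF bij_betw_beta_list])
    have "D = {\<rho> \<in> beta_list k ` partitions k. set \<rho> \<subseteq> {..M}}"
      unfolding bij_betw_imp_surj_on[OF bij_betw_beta_list] D_def by auto
    then show "beta_list k ` A = D" by (auto simp: A_def)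
  qed (auto simp: A_def)
  then have finA: "finite A" using finD bij_betw_finite by blast
  have sub: "{\<mu> \<in> partitions k. T \<mu> \<noteq> 0} \<subseteq> A"
  proof clarify
    fix \<mu> assume \<mu>: "\<mu> \<in> partitions k" "T \<mu> \<noteq> 0"
    show "\<mu> \<in> A"
    proof (rule ccontr)
      assume "\<mu> \<notin> A"
      then have n: "\<not> set (beta_list k \<mu>) \<subseteq> {..M}" using \<mu> by (simp add: A_def)
      have len: "length (beta_list k \<mu>) = k" by (simp add: beta_list_def)
      \<comment> \<open>A permutation keeps the entry above \<open>M\<close>, so every summand of
        \<open>T\<close> vanishes.\<close>
      have "f (permute_list p (beta_list k \<mu>)) = 0" if "p permutes {..<k}" for p
      proof -
        have "set (permute_list p (beta_list k \<mu>)) = set (beta_list k \<mu>)"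
          using that len by (intro set_permute_list) simp
        with n len show ?thesis
          unfolding f_def js_def
          by (subst lookup_shift_coeff_staircase_eq_0[where M = M])
             (simp_all add: M_def extv.scale_zero_left)
      qed
      with \<mu>(2) show False by (simp add: T)
    qed
  qed
  have "sigma_plus_multi k (b_wedge k (replicate k 0)) \<alpha> =
      sigma_plus_multi k (prod_list (map b_vec js)) \<alpha>"
    unfolding b_wedge_conv
    by (rule arg_cong[of _ _ "\<lambda>xs. sigma_plus_multi k (prod_list (map b_vec xs)) \<alpha>"])
       (simp add: beta_list_def js_def)
  also have "\<dots> = (\<Sum>ms | set ms \<subseteq> {..M} \<and> length ms = k. f ms)"
    by (subst sigma_plus_multi_prod_list[where M = M]) (auto simp: js_def M_def f_def)
  \<comment> \<open>Words with a repeated letter have zero wedge product.\<close>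
  also have "\<dots> = (\<Sum>ms | set ms \<subseteq> {..M} \<and> length ms = k \<and> distinct ms. f ms)"
  proof (rule sum.mono_neutral_right[OF fin])
    show "\<forall>ms\<in>{ms. set ms \<subseteq> {..M} \<and> length ms = k} -
        {ms. set ms \<subseteq> {..M} \<and> length ms = k \<and> distinct ms}. f ms = 0"
    proof
      fix ms assume "ms \<in> {ms. set ms \<subseteq> {..M} \<and> length ms = k} -
        {ms. set ms \<subseteq> {..M} \<and> length ms = k \<and> distinct ms}"
      then have "\<not> distinct (map b_vec ms)" by (auto simp: distinct_map)
      then have "prod_list (map b_vec ms) = 0"
        by (intro prod_list_ext_deg1_not_distinct) (auto simp: b_vec_ext_deg1)
      then show "f ms = 0" by (simp add: f_def extv.scale_zero_right)
    qed
  qed auto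
  also have "\<dots> = (\<Sum>\<rho>\<in>D. \<Sum>p | p permutes {..<k}. f (permute_list p \<rho>))"
    unfolding sum_distinct_lists_conv_permute_list D_def by (simp add: sum.cartesian_product)
  also have "\<dots> = (\<Sum>\<mu>\<in>A. T \<mu>)"
    using sum.reindex_bij_betw[OF bij, of "\<lambda>\<rho>. \<Sum>p | p permutes {..<k}. f (permute_list p \<rho>)"]
    by (simp add: T)
  \<comment> \<open>Some members of \<open>A\<close> may contribute zero; the formal sum is taken
    over the nonzero terms only.\<close>
  also have "\<dots> = (\<Sum>\<mu>\<in>{\<mu> \<in> partitions k. T \<mu> \<noteq> 0}. T \<mu>)"
    using finA sub by (intro sum.mono_neutral_right) (auto simp: A_def)
  finally show "finite {x \<in> partitions k. mpoly_scale (schur k x) (b_wedge k x) \<alpha> \<noteq> 0} \<and>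
      (\<Sum>x\<in>{x \<in> partitions k. mpoly_scale (schur k x) (b_wedge k x) \<alpha> \<noteq> 0}.
        mpoly_scale (schur k x) (b_wedge k x) \<alpha>) =
      sigma_plus_multi k (b_wedge k (replicate k 0)) \<alpha>"
    using finite_subset[OF sub finA] by (simp add: T_def)
qed

end
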